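(* Let $a\in(0,1)$ and let $(\mathbb{S}^{3},\varphi,\xi,\eta,g)$ be the unit $3$-sphere with the deformed Sasakian structure of parameter $a$ described in the context. Let $\gamma:I\rightarrow(\mathbb{S}^{3},\varphi,\xi,\eta,g)$ be a Legendre curve parametrized by arc length (with respect to $g$), where $I\subset\mathbb{R}$ is an interval. Then $\gamma$ is proper-biharmonic if and only if, as a curve in $\mathbb{R}^{4}$, $$\gamma(s)=\sqrt{\tfrac{B}{A+B}}\cos(As)\,e_{1}-\sqrt{\tfrac{B}{A+B}}\sin(As)\,Je_{1}+\sqrt{\tfrac{A}{A+B}}\cos(Bs)\,e_{3}+\sqrt{\tfrac{A}{A+B}}\sin(Bs)\,Je_{3},$$ where $\{e_{1},e_{3}\}$ is an orthonormal system of constant vectors in the Euclidean space $(\mathbb{R}^{4},\langle\cdot,\cdot\rangle)$, with $e_{3}$ orthogonal to $Je_{1}$, and $$A=\sqrt{\frac{3-2a-2\sqrt{(a-1)(a-2)}}{a}},\qquad B=\sqrt{\frac{3-2a+2\sqrt{(a-1)(a-2)}}{a}}.$$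
   Context: All manifolds, metrics and maps are smooth. Identify $\mathbb{C}^2$ with $\mathbb{R}^4$, with standard Euclidean inner product $\langle\cdot,\cdot\rangle$ and complex structure $J(x_{1},x_{2},y_{1},y_{2})=(-y_{1},-y_{2},x_{1},x_{2})$. Let $\mathbb{S}^{3}=\{z\in\mathbb{C}^{2}:\|z\|=1\}$ with its standard metric $g_{0}$ induced from $\langle\cdot,\cdot\rangle$. On $\mathbb{S}^3$ set $\xi_{0}(z)=-Jz$, $\eta_0(X)=g_0(X,\xi_0)$, and $\varphi_{0}=s\circ J$, where $s:T_{z}\mathbb{C}^{2}\to T_{z}\mathbb{S}^{3}$ is the orthogonal projection. For a constant $a\in(0,1)$ the deformed structure is $$\eta=a\eta_{0},\quad \xi=\tfrac1a\xi_{0},\quad \varphi=\varphi_{0},\quad g=a\,g_{0}+a(a-1)\,\eta_{0}\otimes\eta_{0}.$$ $(\mathbb{S}^3,\varphi,\xi,\eta,g)$ is a Sasakian space form of constant $\varphi$-sectional curvature $c=\frac4a-3>1$. A Legendre curve is a curve $\gamma$ with $\eta(\gamma')=0$. "Parametrized by arc length" means $g(\gamma',\gamma')=1$. For a smooth map $\phi:(M,g_M)\to(N,h)$ of Riemannian manifolds, the tension field is $\tau(\phi)=\mathrm{trace}\,\nabla d\phi$ and the bitension field is $\tau_{2}(\phi)=-\Delta\tau(\phi)-\mathrm{trace}\,R^{N}(d\phi,\tau(\phi))d\phi$, where $\Delta$ is the rough Laplacian $\Delta=-\mathrm{trace}(\nabla^\phi\nabla^\phi-\nabla^\phi_{\nabla})$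 on sections of $\phi^{-1}TN$ and $R^N(X,Y)=[\nabla_X,\nabla_Y]-\nabla_{[X,Y]}$. The map $\phi$ is harmonic if $\tau(\phi)=0$, biharmonic if $\tau_2(\phi)=0$ (equivalently, $\phi$ is a critical point of the bienergy $E_2(\phi)=\frac12\int_M|\tau(\phi)|^2\nu_{g_M}$), and proper-biharmonic if it is biharmonic and not harmonic. For a curve $\gamma$ parametrized by arc length in $(N,h)$ with $T=\gamma'$, this reads $\tau(\gamma)=\nabla_TT$ and $\tau_2(\gamma)=\nabla_T\nabla_T\nabla_TT-R^N(T,\nabla_TT)T$.
   Formalization: The displayed formula is allowed with s replaced by σs for a sign σ in {1,−1}, because the reversed curve γ(−s) is also a proper-biharmonic Legendre curve parametrized by arc length but is not of the displayed form for any e1, e3. *)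

theory Defs
  imports "HOL-Analysis.Analysis"
begin

section \<open>Smooth maps between normed spaces\<close>

primrec Ck :: "nat \<Rightarrow> ('a::real_normed_vector \<Rightarrow> 'b::real_normed_vector) \<Rightarrow> bool" where
  "Ck 0 f \<longleftrightarrow> continuous_on UNIV f"
| "Ck (Suc k) f \<longleftrightarrow>
     (\<forall>x. f differentiable (at x)) \<and> (\<forall>v. Ck k (\<lambda>x. frechet_derivative f (at x) v))"

definition smooth :: "('a::real_normed_vector \<Rightarrow> 'b::real_normed_vector) \<Rightarrow> bool" where
  "smooth f \<longleftrightarrow> (\<forall>k. Ck k f)"

text \<open>Derivative of \<open>f\<close> at \<open>x\<close> in the direction \<open>v\<close>.\<close>
abbreviation dd :: "('a::real_normed_vector \<Rightarrow> 'b::real_normed_vector) \<Rightarrow> 'a \<Rightarrow> 'a \<Rightarrow> 'b" where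
  "dd f x v \<equiv> frechet_derivative f (at x) v"

section \<open>The unit sphere in \<open>\<real>\<^sup>4 = \<complex>\<^sup>2\<close>\<close>

type_synonym R4 = "real^4"

definition S3 :: "R4 set" where
  "S3 = sphere 0 1"

text \<open>A point of \<open>\<real>\<^sup>4\<close> has the coordinates \<open>(x\<^sub>1, x\<^sub>2, y\<^sub>1, y\<^sub>2)\<close>.\<close>
definition J :: "R4 \<Rightarrow> R4" where
  "J z = vector [- (z$3), - (z$4), z$1, z$2]"

definition tproj :: "R4 \<Rightarrow> R4 \<Rightarrow> R4" where
  "tproj z v = v - (z \<bullet> v) *\<^sub>R z"

text \<open>
  \<open>S3\<close> is a closed submanifold of \<open>\<real>\<^sup>4\<close>, so its smooth functions and vector fields are exactly the
  restrictions of smooth maps on \<open>\<real>\<^sup>4\<close>. They are represented by such extensions; only the values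
  on \<open>S3\<close> matter, and derivatives are only taken in directions tangent to \<open>S3\<close>, where they do
  not depend on the extension.
\<close>
definition vfield :: "(R4 \<Rightarrow> R4) \<Rightarrow> bool" where
  "vfield X \<longleftrightarrow> smooth X \<and> (\<forall>z\<in>S3. z \<bullet> X z = 0)"

definition bracket :: "(R4 \<Rightarrow> R4) \<Rightarrow> (R4 \<Rightarrow> R4) \<Rightarrow> R4 \<Rightarrow> R4" where
  "bracket X Y z = dd Y z (X z) - dd X z (Y z)"

text \<open>A vector field on \<open>S3\<close> with the value \<open>v\<close> at \<open>z\<close>, for every \<open>z\<close> with \<open>v\<close> tangent at \<open>z\<close>.\<close>
definition ext :: "R4 \<Rightarrow> R4 \<Rightarrow> R4" where
  "ext v = (\<lambda>z. tproj z v)"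

section \<open>Connections on \<open>S3\<close>\<close>

type_synonym connection = "(R4 \<Rightarrow> R4) \<Rightarrow> (R4 \<Rightarrow> R4) \<Rightarrow> R4 \<Rightarrow> R4"

text \<open>The second clause says that \<open>D\<close> acts on the vector fields of \<open>S3\<close> themselves, independently
  of the chosen extensions.\<close>
definition affine_connection :: "connection \<Rightarrow> bool" where
  "affine_connection D \<longleftrightarrow>
     (\<forall>X Y. vfield X \<longrightarrow> vfield Y \<longrightarrow> vfield (D X Y)) \<and>
     (\<forall>X X' Y Y'. vfield X \<longrightarrow> vfield X' \<longrightarrow> vfield Y \<longrightarrow> vfield Y' \<longrightarrow>
        (\<forall>z\<in>S3. X z = X' z \<and> Y z = Y' z) \<longrightarrow> (\<forall>z\<in>S3. D X Y z = D X' Y' z)) \<and>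
     (\<forall>X X' Y. vfield X \<longrightarrow> vfield X' \<longrightarrow> vfield Y \<longrightarrow>
        (\<forall>z\<in>S3. D (\<lambda>x. X x + X' x) Y z = D X Y z + D X' Y z)) \<and>
     (\<forall>f X Y. smooth (f :: R4 \<Rightarrow> real) \<longrightarrow> vfield X \<longrightarrow> vfield Y \<longrightarrow>
        (\<forall>z\<in>S3. D (\<lambda>x. f x *\<^sub>R X x) Y z = f z *\<^sub>R D X Y z)) \<and>
     (\<forall>X Y Y'. vfield X \<longrightarrow> vfield Y \<longrightarrow> vfield Y' \<longrightarrow>
        (\<forall>z\<in>S3. D X (\<lambda>x. Y x + Y' x) z = D X Y z + D X Y' z)) \<and>
     (\<forall>f X Y. smooth (f :: R4 \<Rightarrow> real) \<longrightarrow> vfield X \<longrightarrow> vfield Y \<longrightarrow>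
        (\<forall>z\<in>S3. D X (\<lambda>x. f x *\<^sub>R Y x) z = dd f z (X z) *\<^sub>R Y z + f z *\<^sub>R D X Y z))"

type_synonym metric = "R4 \<Rightarrow> R4 \<Rightarrow> R4 \<Rightarrow> real"

definition levi_civita :: "metric \<Rightarrow> connection \<Rightarrow> bool" where
  "levi_civita g D \<longleftrightarrow> affine_connection D \<and>
     (\<forall>X Y. vfield X \<longrightarrow> vfield Y \<longrightarrow> (\<forall>z\<in>S3. D X Y z - D Y X z = bracket X Y z)) \<and>
     (\<forall>X Y Z. vfield X \<longrightarrow> vfield Y \<longrightarrow> vfield Z \<longrightarrow>
        (\<forall>z\<in>S3. dd (\<lambda>x. g x (Y x) (Z x)) z (X z) = g z (D X Y z) (Z z) + g z (Y z) (D X Z z)))"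

text \<open>Unique, as an operator on vector fields of \<open>S3\<close>, by the Koszul formula; existence for the
  metrics used here is \<open>levi_civita_exists\<close> below.\<close>
definition nabla :: "metric \<Rightarrow> connection" where
  "nabla g = (SOME D. levi_civita g D)"

definition curv :: "connection \<Rightarrow> (R4 \<Rightarrow> R4) \<Rightarrow> (R4 \<Rightarrow> R4) \<Rightarrow> (R4 \<Rightarrow> R4) \<Rightarrow> R4 \<Rightarrow> R4" where
  "curv D X Y Z z = D X (D Y Z) z - D Y (D X Z) z - D (bracket X Y) Z z"

text \<open>The curvature is tensorial, so for tangent vectors it may be evaluated on any fields
  extending them.\<close>
definition curv_at :: "connection \<Rightarrow> R4 \<Rightarrow> R4 \<Rightarrow> R4 \<Rightarrow> R4 \<Rightarrow> R4" where
  "curv_at D z u v w = curv D (ext u) (ext v) (ext w) z"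

section \<open>Curves\<close>

text \<open>Derivatives at an endpoint belonging to the interval are one-sided.\<close>
definition smooth_curve :: "real set \<Rightarrow> (real \<Rightarrow> R4) \<Rightarrow> bool" where
  "smooth_curve I \<gamma> \<longleftrightarrow> (\<exists>d. (\<forall>s\<in>I. d 0 s = \<gamma> s) \<and>
     (\<forall>n. \<forall>s\<in>I. (d n has_vector_derivative d (Suc n) s) (at s within I)))"

definition velocity :: "real set \<Rightarrow> (real \<Rightarrow> R4) \<Rightarrow> real \<Rightarrow> R4" where
  "velocity I \<gamma> s = vector_derivative \<gamma> (at s within I)"

text \<open>
  The pull-back connection \<open>\<nabla>\<^sub>T V\<close> for a section \<open>V\<close> of the tangent bundle of \<open>S3\<close> along \<open>\<gamma>\<close>.
  As \<open>V\<close> is tangent, \<open>V = \<Sum>\<^sub>i V\<^sub>i E\<^sub>i \<circ> \<gamma>\<close> with \<open>E\<^sub>i\<close> the projection of the \<open>i\<close>-th standard basis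
  vector; the formula is the Leibniz rule for this sum. The characteristic properties of the
  pull-back connection are \<open>cov_add\<close>, \<open>cov_scale\<close> and \<open>cov_restrict\<close> below.
\<close>
definition cov :: "connection \<Rightarrow> real set \<Rightarrow> (real \<Rightarrow> R4) \<Rightarrow> (real \<Rightarrow> R4) \<Rightarrow> real \<Rightarrow> R4" where
  "cov D I \<gamma> V s = (\<Sum>i\<in>UNIV.
     (vector_derivative V (at s within I) $ i) *\<^sub>R ext (axis i 1) (\<gamma> s)
     + (V s $ i) *\<^sub>R D (ext (velocity I \<gamma> s)) (ext (axis i 1)) (\<gamma> s))"

text \<open>Tension and bitension fields of a curve parametrized by arc length.\<close>

definition tension :: "metric \<Rightarrow> real set \<Rightarrow> (real \<Rightarrow> R4) \<Rightarrow> real \<Rightarrow> R4" where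
  "tension g I \<gamma> = cov (nabla g) I \<gamma> (velocity I \<gamma>)"

definition bitension :: "metric \<Rightarrow> real set \<Rightarrow> (real \<Rightarrow> R4) \<Rightarrow> real \<Rightarrow> R4" where
  "bitension g I \<gamma> s =
     cov (nabla g) I \<gamma> (cov (nabla g) I \<gamma> (cov (nabla g) I \<gamma> (velocity I \<gamma>))) s
     - curv_at (nabla g) (\<gamma> s)
         (velocity I \<gamma> s) (cov (nabla g) I \<gamma> (velocity I \<gamma>) s) (velocity I \<gamma> s)"

definition harmonic :: "metric \<Rightarrow> real set \<Rightarrow> (real \<Rightarrow> R4) \<Rightarrow> bool" where
  "harmonic g I \<gamma> \<longleftrightarrow> (\<forall>s\<in>I. tension g I \<gamma> s = 0)"

definition biharmonic :: "metric \<Rightarrow> real set \<Rightarrow> (real \<Rightarrow> R4) \<Rightarrow> bool" where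
  "biharmonic g I \<gamma> \<longleftrightarrow> (\<forall>s\<in>I. bitension g I \<gamma> s = 0)"

definition proper_biharmonic :: "metric \<Rightarrow> real set \<Rightarrow> (real \<Rightarrow> R4) \<Rightarrow> bool" where
  "proper_biharmonic g I \<gamma> \<longleftrightarrow> biharmonic g I \<gamma> \<and> \<not> harmonic g I \<gamma>"

definition arc_length_param :: "metric \<Rightarrow> real set \<Rightarrow> (real \<Rightarrow> R4) \<Rightarrow> bool" where
  "arc_length_param g I \<gamma> \<longleftrightarrow> (\<forall>s\<in>I. g (\<gamma> s) (velocity I \<gamma> s) (velocity I \<gamma> s) = 1)"

section \<open>The deformed Sasakian structure\<close>

definition xi0 :: "R4 \<Rightarrow> R4" where
  "xi0 z = - J z"

definition eta0 :: "R4 \<Rightarrow> R4 \<Rightarrow> real" where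
  "eta0 z v = v \<bullet> xi0 z"

definition phi0 :: "R4 \<Rightarrow> R4 \<Rightarrow> R4" where
  "phi0 z v = tproj z (J v)"

text \<open>The structure of parameter \<open>a\<close> is \<open>(phi0, xi a, eta a, gmetric a)\<close>.\<close>

definition xi :: "real \<Rightarrow> R4 \<Rightarrow> R4" where
  "xi a z = (1 / a) *\<^sub>R xi0 z"

definition eta :: "real \<Rightarrow> R4 \<Rightarrow> R4 \<Rightarrow> real" where
  "eta a z v = a * eta0 z v"

definition gmetric :: "real \<Rightarrow> metric" where
  "gmetric a z u v = a * (u \<bullet> v) + a * (a - 1) * (eta0 z u * eta0 z v)"

definition legendre :: "real \<Rightarrow> real set \<Rightarrow> (real \<Rightarrow> R4) \<Rightarrow> bool" where
  "legendre a I \<gamma> \<longleftrightarrow> (\<forall>s\<in>I. eta a (\<gamma> s) (velocity I \<gamma> s) = 0)"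

section \<open>Existence of the Levi-Civita connection\<close>

lemma Ck_mono: "Ck (Suc k) f \<Longrightarrow> Ck k f"
proof (induction k arbitrary: f)
  case 0
  then show ?case
    by (auto intro!: continuous_at_imp_continuous_on differentiable_imp_continuous_within)
next
  case (Suc k)
  then show ?case by simp
qed

lemma fd_eq: "(f has_derivative f') (at x) \<Longrightarrow> dd f x v = f' v"
  using frechet_derivative_at by metis

lemma fd_has: "f differentiable (at x) \<Longrightarrow> (f has_derivative dd f x) (at x)"
  by (simp add: frechet_derivative_works)

lemma Ck_const: "Ck k (\<lambda>x. c)"
proof (induction k arbitrary: c)
  case (Suc k)
  have "dd (\<lambda>x::'a. c) x v = 0" for x v
    by (simp add: frechet_derivative_const)
  then show ?case using Suc[of 0] by simp
qed simp

lemma Ck_linear: "bounded_linear f \<Longrightarrow> Ck k f"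
proof (cases k)
  case 0
  assume "bounded_linear f"
  with 0 show ?thesis by (simp add: linear_continuous_on)
next
  case (Suc n)
  assume b: "bounded_linear f"
  then have d: "(f has_derivative f) (at x)" for x
    by (simp add: bounded_linear_imp_has_derivative)
  then have "dd f x v = f v" for x v by (rule fd_eq)
  with d Suc show ?thesis by (auto simp: Ck_const differentiable_def)
qed

lemma Ck_add: "Ck k f \<Longrightarrow> Ck k g \<Longrightarrow> Ck k (\<lambda>x. f x + g x)"
proof (induction k arbitrary: f g)
  case (Suc k)
  have "dd (\<lambda>x. f x + g x) x v = dd f x v + dd g x v" for x v
    using Suc.prems by (intro fd_eq has_derivative_add fd_has) auto
  with Suc show ?case by auto
qed (auto intro: continuous_intros)

lemma Ck_bilinear:
  assumes h: "bounded_bilinear h"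
  shows "Ck k f \<Longrightarrow> Ck k g \<Longrightarrow> Ck k (\<lambda>x. h (f x) (g x))"
proof (induction k arbitrary: f g)
  case 0
  then show ?case by (auto intro: bounded_bilinear.continuous_on[OF h])
next
  case (Suc k)
  have d: "((\<lambda>x. h (f x) (g x)) has_derivative (\<lambda>v. h (f x) (dd g x v) + h (dd f x v) (g x))) (at x)" for x
    using Suc.prems by (intro bounded_bilinear.FDERIV[OF h] fd_has) auto
  have e: "dd (\<lambda>x. h (f x) (g x)) x v = h (f x) (dd g x v) + h (dd f x v) (g x)" for x v
    using d by (rule fd_eq)
  have "Ck k (\<lambda>x. h (f x) (dd g x v) + h (dd f x v) (g x))" for v
    using Suc.prems Ck_mono[OF Suc.prems(1)] Ck_mono[OF Suc.prems(2)]
    by (intro Ck_add Suc.IH) auto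
  with d show ?case by (auto simp: e differentiable_def)
qed

lemma smooth_const: "smooth (\<lambda>x. c)"
  by (simp add: smooth_def Ck_const)

lemma smooth_linear: "bounded_linear f \<Longrightarrow> smooth f"
  by (simp add: smooth_def Ck_linear)

lemma smooth_add: "smooth f \<Longrightarrow> smooth g \<Longrightarrow> smooth (\<lambda>x. f x + g x)"
  by (simp add: smooth_def Ck_add)

lemma smooth_sum: "(\<And>i. i \<in> A \<Longrightarrow> smooth (f i)) \<Longrightarrow> smooth (\<lambda>x. \<Sum>i\<in>A. f i x)"
  by (induction A rule: infinite_finite_induct) (auto intro: smooth_add smooth_const)

lemma smooth_scaleR: "smooth f \<Longrightarrow> smooth g \<Longrightarrow> smooth (\<lambda>x. f x *\<^sub>R g x)"
  by (simp add: smooth_def Ck_bilinear[OF bounded_bilinear_scaleR])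

lemma smooth_mult: "smooth f \<Longrightarrow> smooth g \<Longrightarrow> smooth (\<lambda>x. f x * g x :: real)"
  by (simp add: smooth_def Ck_bilinear[OF bounded_bilinear_mult])

lemma smooth_inner: "smooth f \<Longrightarrow> smooth g \<Longrightarrow> smooth (\<lambda>x. f x \<bullet> g x)"
  by (simp add: smooth_def Ck_bilinear[OF bounded_bilinear_inner])

lemma smooth_uminus: "smooth f \<Longrightarrow> smooth (\<lambda>x. - f x)"
  using smooth_scaleR[OF smooth_const[of "-1"], of f] by simp

lemma smooth_diff: "smooth f \<Longrightarrow> smooth g \<Longrightarrow> smooth (\<lambda>x. f x - g x)"
  using smooth_add[OF _ smooth_uminus, of f g] by simp

lemma smooth_id: "smooth (\<lambda>x. x)"
  by (intro smooth_linear bounded_linear_ident)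

lemma smooth_differentiable: "smooth f \<Longrightarrow> f differentiable (at x)"
  unfolding smooth_def by (metis Ck.simps(2))

lemma smooth_has: "smooth f \<Longrightarrow> (f has_derivative dd f x) (at x)"
  by (intro fd_has smooth_differentiable)

lemma smooth_dd: "smooth f \<Longrightarrow> smooth (\<lambda>x. dd f x v)"
  unfolding smooth_def by (metis Ck.simps(2))

lemma dd_linear: "smooth f \<Longrightarrow> linear (dd f x)"
  using smooth_has has_derivative_linear by blast

lemma J_nth [simp]: "J z $ 1 = - (z$3)" "J z $ 2 = - (z$4)" "J z $ 3 = z$1" "J z $ 4 = z$2"
  by (simp_all add: J_def vector_def)

lemma inner4: "(x::R4) \<bullet> y = x$1 * y$1 + x$2 * y$2 + x$3 * y$3 + x$4 * y$4"
  by (simp add: inner_vec_def sum_4)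

lemma J_linear: "linear J"
  by (rule linearI) (simp_all add: vec_eq_iff forall_4)

lemma J_add: "J (x + y) = J x + J y" and J_scale: "J (c *\<^sub>R x) = c *\<^sub>R J x"
  and J_diff: "J (x - y) = J x - J y"
  using J_linear by (simp_all add: linear_add linear_scale linear_diff)

lemma J_skew: "J x \<bullet> y = - (x \<bullet> J y)"
  by (simp add: inner4)

lemma J_self: "x \<bullet> J x = 0" "J x \<bullet> x = 0"
  by (simp_all add: inner4)

lemma J_inner: "J x \<bullet> J y = x \<bullet> y"
  by (simp add: inner4)

lemma smooth_J: "smooth f \<Longrightarrow> smooth (\<lambda>x. J (f x))"
proof -
  assume f: "smooth f"
  have b: "bounded_linear J" using J_linear linear_conv_bounded_linear by blast
  have "Ck k f \<Longrightarrow> Ck k (\<lambda>x. J (f x))" for k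
  proof (induction k arbitrary: f)
    case 0
    then show ?case by (simp add: bounded_linear.continuous_on[OF b])
  next
    case (Suc k)
    have d: "((\<lambda>x. J (f x)) has_derivative (\<lambda>v. J (dd f x v))) (at x)" for x
      using Suc.prems by (intro bounded_linear.has_derivative[OF b] fd_has) auto
    have "dd (\<lambda>x. J (f x)) x v = J (dd f x v)" for x v using d by (rule fd_eq)
    with d Suc show ?case by (auto simp: differentiable_def)
  qed
  with f show ?thesis by (simp add: smooth_def)
qed

lemma S3_inner: "z \<in> S3 \<Longrightarrow> z \<bullet> z = 1"
  by (simp add: S3_def norm_eq_1)

lemma tproj_tangent: "z \<in> S3 \<Longrightarrow> z \<bullet> tproj z v = 0"
  by (simp add: tproj_def inner_diff_right S3_inner)

lemma tproj_id: "z \<bullet> v = 0 \<Longrightarrow> tproj z v = v"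
  by (simp add: tproj_def)

lemma tproj_linear: "linear (tproj z)"
  by (rule linearI) (simp_all add: tproj_def inner_add_right algebra_simps)

lemma vfield_ext: "vfield (ext v)"
proof -
  have "smooth (ext v)"
    unfolding ext_def tproj_def
    by (intro smooth_diff smooth_scaleR smooth_inner smooth_const smooth_id)
  then show ?thesis by (simp add: vfield_def ext_def tproj_tangent)
qed

text \<open>Derivatives in tangent directions depend only on the values on \<open>S3\<close>.\<close>
lemma dd_cong_S3:
  fixes f g :: "R4 \<Rightarrow> 'b::real_normed_vector"
  assumes f: "smooth f" and g: "smooth g" and eq: "\<And>x. x \<in> S3 \<Longrightarrow> f x = g x"
    and z: "z \<in> S3" and v: "z \<bullet> v = 0"
  shows "dd f z v = dd g z v"
proof (cases "v = 0")
  case True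
  then show ?thesis using f g by (simp add: linear_0 dd_linear)
next
  case False
  define r where "r = norm v"
  define w where "w = v /\<^sub>R r"
  have r: "r > 0" using False by (simp add: r_def)
  have zz: "z \<bullet> z = 1" using z by (rule S3_inner)
  have ww: "w \<bullet> w = 1" using r by (simp add: w_def r_def field_simps power2_eq_square dot_square_norm)
  have zw: "z \<bullet> w = 0" "w \<bullet> z = 0" using v by (simp_all add: w_def inner_commute)
  define c where "c = (\<lambda>t::real. cos t *\<^sub>R z + sin t *\<^sub>R w)"
  have c: "c t \<in> S3" for t
  proof -
    have "c t \<bullet> c t = (cos t)\<^sup>2 + (sin t)\<^sup>2"
      by (simp add: c_def inner_add_left inner_add_right zz ww zw power2_eq_square)
    then show ?thesis by (simp add: S3_def norm_eq_1)
  qed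
  have c0: "c 0 = z" by (simp add: c_def)
  have "(c has_derivative (\<lambda>h. h *\<^sub>R w)) (at 0)"
    unfolding c_def by (auto intro!: derivative_eq_intros)
  moreover have "(f has_derivative dd f z) (at (c 0))" "(g has_derivative dd g z) (at (c 0))"
    using smooth_has[OF f] smooth_has[OF g] by (simp_all add: c0)
  ultimately have "((\<lambda>t. f (c t)) has_derivative (\<lambda>h. dd f z (h *\<^sub>R w))) (at 0)"
    and "((\<lambda>t. g (c t)) has_derivative (\<lambda>h. dd g z (h *\<^sub>R w))) (at 0)"
    using has_derivative_compose by blast+
  moreover have "(\<lambda>t. f (c t)) = (\<lambda>t. g (c t))" using eq c by auto
  ultimately have "(\<lambda>h. dd f z (h *\<^sub>R w)) = (\<lambda>h. dd g z (h *\<^sub>R w))"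
    by (metis has_derivative_unique)
  then have "dd f z (r *\<^sub>R w) = dd g z (r *\<^sub>R w)" by metis
  then show ?thesis using r by (simp add: w_def)
qed

text \<open>The Levi-Civita connection of the round metric, which is the tangential part of the Euclidean
  derivative, plus a symmetric tensor compensating the non-parallel term in \<open>gmetric a\<close>.\<close>
definition D0 :: "real \<Rightarrow> connection" where
  "D0 a X Y x = tproj x (dd Y x (X x))
     + (1 - a) *\<^sub>R (eta0 x (X x) *\<^sub>R phi0 x (Y x) + eta0 x (Y x) *\<^sub>R phi0 x (X x))"

lemma D0_vfield:
  assumes X: "vfield X" and Y: "vfield Y"
  shows "vfield (D0 a X Y)"
proof -
  have s: "smooth X" "smooth Y" using X Y by (simp_all add: vfield_def)
  have e: "dd Y x (X x) = (\<Sum>i\<in>UNIV. (X x \<bullet> axis i 1) *\<^sub>R dd Y x (axis i 1))" for x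
  proof -
    have "dd Y x (X x) = dd Y x (\<Sum>i\<in>UNIV. (X x $ i) *\<^sub>R axis i 1)"
      by (simp add: basis_expansion scalar_mult_eq_scaleR[symmetric])
    also have "\<dots> = (\<Sum>i\<in>UNIV. (X x $ i) *\<^sub>R dd Y x (axis i 1))"
      using dd_linear[OF s(2)] by (simp add: linear_sum linear_scale)
    finally show ?thesis by (simp add: inner_axis)
  qed
  have sm: "smooth (\<lambda>x. dd Y x (X x))"
    unfolding e using s
    by (auto intro!: smooth_sum smooth_scaleR smooth_inner smooth_const smooth_dd)
  have "smooth (D0 a X Y)"
    unfolding D0_def[abs_def] tproj_def eta0_def phi0_def xi0_def using s sm
    by (intro smooth_diff smooth_add smooth_uminus smooth_scaleR smooth_inner smooth_const
        smooth_id smooth_J)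
  moreover have "z \<bullet> D0 a X Y z = 0" if "z \<in> S3" for z
    using that by (simp add: D0_def phi0_def inner_add_right tproj_tangent)
  ultimately show ?thesis by (simp add: vfield_def)
qed

lemma phi0_linear: "phi0 z (x + y) = phi0 z x + phi0 z y" "phi0 z (c *\<^sub>R x) = c *\<^sub>R phi0 z x"
  by (simp_all add: phi0_def J_add J_scale linear_add[OF tproj_linear] linear_scale[OF tproj_linear])

lemma eta0_linear: "eta0 z (x + y) = eta0 z x + eta0 z y" "eta0 z (c *\<^sub>R x) = c * eta0 z x"
  by (simp_all add: eta0_def inner_add_left algebra_simps)

lemma D0_affine: "affine_connection (D0 a)"
  unfolding affine_connection_def
proof (intro conjI allI impI ballI)
  fix X Y assume "vfield X" "vfield Y" then show "vfield (D0 a X Y)" by (rule D0_vfield)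
next
  fix X X' Y Y' z
  assume v: "vfield X" "vfield X'" "vfield Y" "vfield Y'"
    and e: "\<forall>z\<in>S3. X z = X' z \<and> Y z = Y' z" and z: "z \<in> S3"
  have "dd Y z (X z) = dd Y' z (X z)"
    using v e z by (intro dd_cong_S3) (auto simp: vfield_def)
  with e z show "D0 a X Y z = D0 a X' Y' z" by (simp add: D0_def)
next
  fix X X' Y z assume "vfield X" "vfield X'" "vfield Y"
  then have "linear (dd Y z)" by (simp add: dd_linear vfield_def)
  then show "D0 a (\<lambda>x. X x + X' x) Y z = D0 a X Y z + D0 a X' Y z"
    by (simp add: D0_def phi0_linear eta0_linear linear_add linear_add[OF tproj_linear] algebra_simps)
next
  fix f :: "R4 \<Rightarrow> real" and X Y z assume "vfield X" "vfield Y"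
  then have "linear (dd Y z)" by (simp add: dd_linear vfield_def)
  then show "D0 a (\<lambda>x. f x *\<^sub>R X x) Y z = f z *\<^sub>R D0 a X Y z"
    by (simp add: D0_def phi0_linear eta0_linear linear_scale linear_scale[OF tproj_linear] algebra_simps)
next
  fix X Y Y' z assume "vfield X" "vfield Y" "vfield Y'"
  then have "dd (\<lambda>x. Y x + Y' x) z v = dd Y z v + dd Y' z v" for v
    by (intro fd_eq has_derivative_add smooth_has) (auto simp: vfield_def)
  then show "D0 a X (\<lambda>x. Y x + Y' x) z = D0 a X Y z + D0 a X Y' z"
    by (simp add: D0_def phi0_linear eta0_linear linear_add[OF tproj_linear] algebra_simps)
next
  fix f :: "R4 \<Rightarrow> real" and X Y z assume f: "smooth f" and v: "vfield X" "vfield Y" and z: "z \<in> S3"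
  then have "dd (\<lambda>x. f x *\<^sub>R Y x) z v = f z *\<^sub>R dd Y z v + dd f z v *\<^sub>R Y z" for v
    by (intro fd_eq has_derivative_scaleR smooth_has) (auto simp: vfield_def)
  moreover have "tproj z (Y z) = Y z" using v z by (simp add: vfield_def tproj_id)
  ultimately show "D0 a X (\<lambda>x. f x *\<^sub>R Y x) z = dd f z (X z) *\<^sub>R Y z + f z *\<^sub>R D0 a X Y z"
    by (simp add: D0_def phi0_linear eta0_linear linear_add[OF tproj_linear]
        linear_scale[OF tproj_linear] algebra_simps)
qed

lemma bracket_tangent:
  assumes X: "vfield X" and Y: "vfield Y" and z: "z \<in> S3"
  shows "z \<bullet> bracket X Y z = 0"
proof -
  have t: "z \<bullet> dd Z z (W z) = - (W z \<bullet> Z z)" if W: "vfield W" and Z: "vfield Z" for W Z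
  proof -
    have "dd (\<lambda>x. x \<bullet> Z x) z (W z) = dd (\<lambda>x. 0::real) z (W z)"
      using W Z z by (intro dd_cong_S3) (auto simp: vfield_def intro!: smooth_inner smooth_id smooth_const)
    moreover have "dd (\<lambda>x. x \<bullet> Z x) z (W z) = z \<bullet> dd Z z (W z) + W z \<bullet> Z z"
      using Z by (intro fd_eq has_derivative_inner smooth_has has_derivative_ident) (auto simp: vfield_def)
    ultimately show ?thesis by simp
  qed
  show ?thesis
    by (simp add: bracket_def inner_diff_right t X Y inner_commute)
qed

lemma levi_civita_D0: "levi_civita (gmetric a) (D0 a)"
  unfolding levi_civita_def
proof (intro conjI allI impI ballI)
  show "affine_connection (D0 a)" by (rule D0_affine)
next
  fix X Y z assume v: "vfield X" "vfield Y" "z \<in> S3"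
  have "D0 a X Y z - D0 a Y X z = tproj z (bracket X Y z)"
    by (simp add: D0_def bracket_def linear_diff[OF tproj_linear] algebra_simps)
  with v show "D0 a X Y z - D0 a Y X z = bracket X Y z"
    by (simp add: bracket_tangent tproj_id)
next
  fix X Y Z z assume v: "vfield X" "vfield Y" "vfield Z" and z: "z \<in> S3"
  define x where "x = X z"
  define y where "y = Y z"
  define w where "w = Z z"
  define y' where "y' = dd Y z x"
  define w' where "w' = dd Z z x"
  have t: "z \<bullet> x = 0" "z \<bullet> y = 0" "z \<bullet> w = 0" using v z by (auto simp: vfield_def x_def y_def w_def)
  have t': "x \<bullet> z = 0" "y \<bullet> z = 0" "w \<bullet> z = 0" using t by (simp_all add: inner_commute)
  have hY: "(Y has_derivative dd Y z) (at z)" and hZ: "(Z has_derivative dd Z z) (at z)"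
    using v by (auto simp: vfield_def intro: smooth_has)
  have b: "bounded_linear J" using J_linear linear_conv_bounded_linear by blast
  have hJ: "((\<lambda>x. - J x) has_derivative (\<lambda>v. - J v)) (at z)"
    by (intro has_derivative_minus bounded_linear.has_derivative[OF b] has_derivative_ident)
  have d: "((\<lambda>p. gmetric a p (Y p) (Z p)) has_derivative
     (\<lambda>v. a * (Y z \<bullet> dd Z z v + dd Y z v \<bullet> Z z)
        + a * (a - 1) * ((Y z \<bullet> - J z) * (Z z \<bullet> - J v + dd Z z v \<bullet> - J z)
           + (Y z \<bullet> - J v + dd Y z v \<bullet> - J z) * (Z z \<bullet> - J z)))) (at z)"
    unfolding gmetric_def eta0_def xi0_def
    by (intro has_derivative_add has_derivative_mult_right has_derivative_mult has_derivative_inner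
        hY hZ hJ)
  have L: "dd (\<lambda>p. gmetric a p (Y p) (Z p)) z (X z) =
     a * (y \<bullet> w' + y' \<bullet> w)
        + a * (a - 1) * ((y \<bullet> - J z) * (w \<bullet> - J x + w' \<bullet> - J z)
           + (y \<bullet> - J x + y' \<bullet> - J z) * (w \<bullet> - J z))"
    unfolding fd_eq[OF d] by (simp add: x_def y_def w_def y'_def w'_def)
  have DY: "D0 a X Y z = y' - (z \<bullet> y') *\<^sub>R z + (1 - a) *\<^sub>R ((x \<bullet> - J z) *\<^sub>R (J y - (z \<bullet> J y) *\<^sub>R z)
      + (y \<bullet> - J z) *\<^sub>R (J x - (z \<bullet> J x) *\<^sub>R z))"
    by (simp add: D0_def tproj_def eta0_def xi0_def phi0_def x_def y_def y'_def)
  have DZ: "D0 a X Z z = w' - (z \<bullet> w') *\<^sub>R z + (1 - a) *\<^sub>R ((x \<bullet> - J z) *\<^sub>R (J w - (z \<bullet> J w) *\<^sub>R z)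
      + (w \<bullet> - J z) *\<^sub>R (J x - (z \<bullet> J x) *\<^sub>R z))"
    by (simp add: D0_def tproj_def eta0_def xi0_def phi0_def x_def w_def w'_def)
  have nz: "J y \<bullet> J z = 0" "J x \<bullet> J z = 0" "J w \<bullet> J z = 0" using t' by (simp_all add: J_inner)
  have jz: "z \<bullet> J z = 0" by (rule J_self)
  have sk: "z \<bullet> J x = - (x \<bullet> J z)" "J x \<bullet> w = w \<bullet> J x" "J y \<bullet> w = - (y \<bullet> J w)"
    by (metis J_skew inner_commute)+
  have eY: "D0 a X Y z \<bullet> J z = y' \<bullet> J z" and eZ: "D0 a X Z z \<bullet> J z = w' \<bullet> J z"
    by (simp_all add: DY DZ inner_add_left inner_diff_left nz jz)
  have iY: "D0 a X Y z \<bullet> w = y' \<bullet> w + (1 - a) * ((x \<bullet> J z) * (y \<bullet> J w) - (y \<bullet> J z) * (w \<bullet> J x))"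
    by (simp add: DY inner_add_left inner_diff_left t sk algebra_simps)
  have iZ: "y \<bullet> D0 a X Z z = y \<bullet> w' + (1 - a) * (- (x \<bullet> J z) * (y \<bullet> J w) - (w \<bullet> J z) * (y \<bullet> J x))"
    by (simp add: DZ inner_add_right inner_diff_right t' algebra_simps)
  show "dd (\<lambda>p. gmetric a p (Y p) (Z p)) z (X z) =
      gmetric a z (D0 a X Y z) (Z z) + gmetric a z (Y z) (D0 a X Z z)"
    unfolding L unfolding gmetric_def eta0_def xi0_def inner_minus_right
      y_def[symmetric] w_def[symmetric] eY eZ iY iZ
    by algebra
qed

lemma levi_civita_exists: "\<exists>D. levi_civita (gmetric a) D"
  using levi_civita_D0 by blast

lemma levi_civita_nabla: "levi_civita (gmetric a) (nabla (gmetric a))"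
  unfolding nabla_def using levi_civita_D0 by (rule someI[where P = "levi_civita (gmetric a)"])

section \<open>Characteristic properties of the pull-back connection\<close>

lemma vec_sum_axis: "(v::R4) = (\<Sum>i\<in>UNIV. (v $ i) *\<^sub>R axis i 1)"
  by (simp add: basis_expansion scalar_mult_eq_scaleR[symmetric])

lemma sum_ext: "(\<Sum>i\<in>UNIV. (v $ i) *\<^sub>R ext (axis i 1) z) = tproj z v"
  by (subst (2) vec_sum_axis)
     (simp add: ext_def linear_sum[OF tproj_linear] linear_scale[OF tproj_linear])

lemma vfield_add: "vfield X \<Longrightarrow> vfield Y \<Longrightarrow> vfield (\<lambda>x. X x + Y x)"
  by (auto simp: vfield_def inner_add_right intro: smooth_add)

lemma vfield_scale: "smooth f \<Longrightarrow> vfield X \<Longrightarrow> vfield (\<lambda>x. f x *\<^sub>R X x)"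
  by (auto simp: vfield_def intro: smooth_scaleR)


lemma vfield_sum:
  "(\<And>i. i \<in> A \<Longrightarrow> vfield (X i)) \<Longrightarrow> vfield (\<lambda>x. \<Sum>i\<in>A. X i x)"
  by (auto simp: vfield_def inner_sum_right intro: smooth_sum)

lemma smooth_nth: "smooth X \<Longrightarrow> smooth (\<lambda>x. X x $ i)" for X :: "R4 \<Rightarrow> R4"
  using smooth_inner[OF _ smooth_const[of "axis i 1"], of X] by (simp add: inner_axis)

lemma dd_nth: "smooth X \<Longrightarrow> dd (\<lambda>x. X x $ i) z v = dd X z v $ i" for X :: "R4 \<Rightarrow> R4"
  by (intro fd_eq bounded_linear.has_derivative[OF bounded_linear_vec_nth] smooth_has)

context
  fixes D assumes D: "affine_connection D"
begin

lemma D_cong: "vfield X \<Longrightarrow> vfield X' \<Longrightarrow> vfield Y \<Longrightarrow> vfield Y' \<Longrightarrow>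
    (\<And>x. x \<in> S3 \<Longrightarrow> X x = X' x) \<Longrightarrow> (\<And>x. x \<in> S3 \<Longrightarrow> Y x = Y' x) \<Longrightarrow> z \<in> S3 \<Longrightarrow>
    D X Y z = D X' Y' z"
  using D unfolding affine_connection_def by meson

lemma D_add1: "vfield X \<Longrightarrow> vfield X' \<Longrightarrow> vfield Y \<Longrightarrow> z \<in> S3 \<Longrightarrow>
    D (\<lambda>x. X x + X' x) Y z = D X Y z + D X' Y z"
  and D_scale1: "smooth f \<Longrightarrow> vfield X \<Longrightarrow> vfield Y \<Longrightarrow> z \<in> S3 \<Longrightarrow>
    D (\<lambda>x. f x *\<^sub>R X x) Y z = f z *\<^sub>R D X Y z"
  and D_add2: "vfield X \<Longrightarrow> vfield Y \<Longrightarrow> vfield Y' \<Longrightarrow> z \<in> S3 \<Longrightarrow>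
    D X (\<lambda>x. Y x + Y' x) z = D X Y z + D X Y' z"
  and D_scale2: "smooth f \<Longrightarrow> vfield X \<Longrightarrow> vfield Y \<Longrightarrow> z \<in> S3 \<Longrightarrow>
    D X (\<lambda>x. f x *\<^sub>R Y x) z = dd f z (X z) *\<^sub>R Y z + f z *\<^sub>R D X Y z"
  using D unfolding affine_connection_def by blast+

lemma D_sum1:
  assumes "finite A" "\<And>i. smooth (f i)" "\<And>i. vfield (X i)" "vfield Y" "z \<in> S3"
  shows "D (\<lambda>x. \<Sum>i\<in>A. f i x *\<^sub>R X i x) Y z = (\<Sum>i\<in>A. f i z *\<^sub>R D (X i) Y z)"
  using assms(1)
proof (induction A rule: finite_induct)
  case empty
  have "D (\<lambda>x. 0 *\<^sub>R X undefined x) Y z = 0 *\<^sub>R D (X undefined) Y z"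
    using assms by (intro D_scale1 smooth_const) auto
  then show ?case by simp
next
  case (insert j A)
  have "D (\<lambda>x. f j x *\<^sub>R X j x + (\<Sum>i\<in>A. f i x *\<^sub>R X i x)) Y z
      = D (\<lambda>x. f j x *\<^sub>R X j x) Y z + D (\<lambda>x. \<Sum>i\<in>A. f i x *\<^sub>R X i x) Y z"
    using assms by (intro D_add1 vfield_scale vfield_sum) auto
  with insert assms show ?case by (simp add: D_scale1)
qed

lemma D_sum2:
  assumes "finite A" "\<And>i. smooth (f i)" "\<And>i. vfield (Y i)" "vfield X" "z \<in> S3"
  shows "D X (\<lambda>x. \<Sum>i\<in>A. f i x *\<^sub>R Y i x) z
    = (\<Sum>i\<in>A. dd (f i) z (X z) *\<^sub>R Y i z + f i z *\<^sub>R D X (Y i) z)"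
  using assms(1)
proof (induction A rule: finite_induct)
  case empty
  have "D X (\<lambda>x. 0 *\<^sub>R Y undefined x) z
      = dd (\<lambda>x. 0) z (X z) *\<^sub>R Y undefined z + 0 *\<^sub>R D X (Y undefined) z"
    using assms by (intro D_scale2 smooth_const) auto
  then show ?case by (simp add: frechet_derivative_const)
next
  case (insert j A)
  have "D X (\<lambda>x. f j x *\<^sub>R Y j x + (\<Sum>i\<in>A. f i x *\<^sub>R Y i x)) z
      = D X (\<lambda>x. f j x *\<^sub>R Y j x) z + D X (\<lambda>x. \<Sum>i\<in>A. f i x *\<^sub>R Y i x) z"
    using assms by (intro D_add2 vfield_scale vfield_sum) auto
  with insert assms show ?case by (simp add: D_scale2)
qed

lemma vfield_expand:
  assumes "vfield X"
  shows "vfield (\<lambda>x. \<Sum>i\<in>UNIV. (X x $ i) *\<^sub>R ext (axis i 1) x)"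
    and "x \<in> S3 \<Longrightarrow> X x = (\<Sum>i\<in>UNIV. (X x $ i) *\<^sub>R ext (axis i 1) x)"
proof -
  show "vfield (\<lambda>x. \<Sum>i\<in>UNIV. (X x $ i) *\<^sub>R ext (axis i 1) x)"
    using assms by (intro vfield_sum vfield_scale smooth_nth vfield_ext) (simp add: vfield_def)
  show "X x = (\<Sum>i\<in>UNIV. (X x $ i) *\<^sub>R ext (axis i 1) x)" if "x \<in> S3"
    using assms that by (simp add: vfield_def sum_ext tproj_id)
qed

lemma D_point1:
  assumes X: "vfield X" and X': "vfield X'" and Y: "vfield Y" and z: "z \<in> S3" and e: "X z = X' z"
  shows "D X Y z = D X' Y z"
proof -
  have "D W Y z = (\<Sum>i\<in>UNIV. (W z $ i) *\<^sub>R D (ext (axis i 1)) Y z)" if W: "vfield W" for W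
  proof -
    have "D W Y z = D (\<lambda>x. \<Sum>i\<in>UNIV. (W x $ i) *\<^sub>R ext (axis i 1) x) Y z"
      by (intro D_cong vfield_expand W Y refl z)
    also have "\<dots> = (\<Sum>i\<in>UNIV. (W z $ i) *\<^sub>R D (ext (axis i 1)) Y z)"
      using W by (intro D_sum1 smooth_nth vfield_ext Y z) (auto simp: vfield_def)
    finally show ?thesis .
  qed
  with X X' e show ?thesis by simp
qed

lemma cov_restrict:
  assumes X: "vfield X" and Y: "vfield Y"
    and s: "s \<in> I" and ne: "at s within I \<noteq> bot" and im: "\<gamma> ` I \<subseteq> S3"
    and \<gamma>: "\<gamma> differentiable (at s within I)" and Xs: "X (\<gamma> s) = velocity I \<gamma> s"
  shows "cov D I \<gamma> (\<lambda>t. Y (\<gamma> t)) s = D X Y (\<gamma> s)"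
proof -
  define z where "z = \<gamma> s"
  define T where "T = velocity I \<gamma> s"
  have z: "z \<in> S3" using im s by (auto simp: z_def)
  have T: "z \<bullet> T = 0" using X z Xs by (auto simp: vfield_def z_def T_def)
  have sY: "smooth Y" using Y by (simp add: vfield_def)
  have "(\<gamma> has_vector_derivative T) (at s within I)"
    using \<gamma> by (simp add: T_def velocity_def vector_derivative_works)
  then have "((\<lambda>t. Y (\<gamma> t)) has_vector_derivative dd Y z T) (at s within I)"
    using vector_derivative_diff_chain_within[OF _ has_derivative_at_withinI[OF smooth_has[OF sY]]]
    by (fastforce simp: o_def z_def)
  then have V: "vector_derivative (\<lambda>t. Y (\<gamma> t)) (at s within I) = dd Y z T"
    using ne by (intro vector_derivative_within)
  have eT: "ext T z = T" by (simp add: ext_def tproj_id T)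
  have "D X Y z = D X (\<lambda>x. \<Sum>i\<in>UNIV. (Y x $ i) *\<^sub>R ext (axis i 1) x) z"
    by (intro D_cong vfield_expand X Y refl z)
  also have "\<dots> = (\<Sum>i\<in>UNIV. dd (\<lambda>x. Y x $ i) z (X z) *\<^sub>R ext (axis i 1) z
      + (Y z $ i) *\<^sub>R D X (ext (axis i 1)) z)"
    by (intro D_sum2 smooth_nth sY vfield_ext X z finite)
  also have "\<dots> = (\<Sum>i\<in>UNIV. (dd Y z T $ i) *\<^sub>R ext (axis i 1) z
      + (Y z $ i) *\<^sub>R D (ext T) (ext (axis i 1)) z)"
    using Xs eT X z
    by (intro sum.cong refl arg_cong2[of _ _ _ _ "(+)"] arg_cong2[of _ _ _ _ "(*\<^sub>R)"] D_point1 vfield_ext)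
       (auto simp: z_def T_def dd_nth sY)
  finally show ?thesis by (simp add: cov_def V z_def T_def)
qed

end

lemma cov_add:
  assumes ne: "at s within I \<noteq> bot"
    and V: "V differentiable (at s within I)" and W: "W differentiable (at s within I)"
  shows "cov D I \<gamma> (\<lambda>t. V t + W t) s = cov D I \<gamma> V s + cov D I \<gamma> W s"
proof -
  have "vector_derivative (\<lambda>t. V t + W t) (at s within I)
      = vector_derivative V (at s within I) + vector_derivative W (at s within I)"
    using assms
    by (intro vector_derivative_within has_vector_derivative_add) (auto simp: vector_derivative_works)
  then show ?thesis by (simp add: cov_def algebra_simps sum.distrib)
qed

lemma cov_scale:
  assumes ne: "at s within I \<noteq> bot"
    and f: "f differentiable (at s within I)" and V: "V differentiable (at s within I)"
    and t: "\<gamma> s \<bullet> V s = 0"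
  shows "cov D I \<gamma> (\<lambda>t. f t *\<^sub>R V t) s
    = vector_derivative f (at s within I) *\<^sub>R V s + f s *\<^sub>R cov D I \<gamma> V s"
proof -
  have "(f has_field_derivative vector_derivative f (at s within I)) (at s within I)"
    using f by (simp add: vector_derivative_works has_real_derivative_iff_has_vector_derivative)
  then have d: "vector_derivative (\<lambda>t. f t *\<^sub>R V t) (at s within I)
      = f s *\<^sub>R vector_derivative V (at s within I) + vector_derivative f (at s within I) *\<^sub>R V s"
    using V ne
    by (intro vector_derivative_within has_vector_derivative_scaleR) (auto simp: vector_derivative_works)
  have "V s = (\<Sum>i\<in>UNIV. (V s $ i) *\<^sub>R ext (axis i 1) (\<gamma> s))"
    using t by (simp add: sum_ext tproj_id)
  then have "vector_derivative f (at s within I) *\<^sub>R V s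
      = (\<Sum>i\<in>UNIV. (vector_derivative f (at s within I) * V s $ i) *\<^sub>R ext (axis i 1) (\<gamma> s))"
    by (metis (no_types, lifting) scaleR_sum_right scaleR_scaleR sum.cong)
  moreover have "cov D I \<gamma> (\<lambda>t. f t *\<^sub>R V t) s
      = (\<Sum>i\<in>UNIV. (vector_derivative f (at s within I) * V s $ i) *\<^sub>R ext (axis i 1) (\<gamma> s))
        + f s *\<^sub>R cov D I \<gamma> V s"
    by (simp add: cov_def d algebra_simps sum.distrib scaleR_sum_right)
  ultimately show ?thesis by simp
qed

end

theory Submission
  imports Defs
begin

text \<open>
  On a Legendre curve parametrized by arc length the vectors \<open>T = \<gamma>'\<close>, \<open>J T\<close> and \<open>\<xi> = - J \<gamma> / a\<close>
  form an orthonormal frame of the deformed metric. Hence the curve is governed by one function,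
  the signed curvature \<open>\<kappa>\<close> with \<open>\<nabla>\<^sub>T T = \<kappa> J T\<close>, and the Sasakian structure equations give
  \<open>\<nabla>\<^sub>T (J T) = \<xi> - \<kappa> T\<close> and \<open>\<nabla>\<^sub>T \<xi> = - J T\<close>. Differentiating twice more and using the
  curvature \<open>R (T, J T) T = - (4 / a - 3) J T\<close> (\<open>curv_at_nabla\<close>), the bitension field is
  \<open>(\<kappa>'' + \<kappa> (4 / a - 4 - \<kappa>\<^sup>2)) J T + 2 \<kappa>' \<xi> - 3 \<kappa> \<kappa>' T\<close> (\<open>bitension_eq\<close>). So the curve is
  proper-biharmonic exactly if \<open>\<kappa>\<close> is constant with \<open>\<kappa>\<^sup>2 = 4 / a - 4\<close>
  (\<open>proper_biharmonic_iff\<close>).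

  In \<open>\<real>\<^sup>4\<close> the definition of \<open>\<kappa>\<close> reads \<open>\<gamma>'' = - \<gamma> / a + \<kappa> J \<gamma>'\<close> (\<open>acceleration\<close>). The frequencies
  \<open>A\<close>, \<open>B\<close> satisfy \<open>A B = 1 / a\<close> and \<open>(B - A)\<^sup>2 = 4 / a - 4\<close> (\<open>frequencies\<close>), so \<open>\<kappa>\<close> is
  \<open>\<sigma> (B - A)\<close> for a sign \<open>\<sigma>\<close>, and reading \<open>J\<close> as the imaginary unit this is a complex linear
  equation with constant coefficients and roots \<open>- \<sigma> A J\<close>, \<open>\<sigma> B J\<close>. Its solutions are sums of two
  circular motions. The conditions \<open>\<gamma> \<bullet> \<gamma> = 1\<close>, \<open>T \<bullet> J \<gamma> = 0\<close> and \<open>T \<bullet> T = 1 / a\<close> fix the radii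
  of the two circles and make their planes orthogonal (\<open>constant_curvature_imp_helix\<close>);
  conversely such a sum solves the equation (\<open>helix_imp_constant_curvature\<close>).

  All this concerns the Levi-Civita connection chosen by \<open>nabla\<close>. By uniqueness it agrees on the
  sphere with the explicit connection \<open>D0 a\<close> (\<open>nabla_eq_D0\<close>), with which the covariant
  derivatives and the curvature are computed.
\<close>

section \<open>The Levi-Civita connection of the deformed metric\<close>

text \<open>The deformation shrinks only the component along \<open>xi0 z\<close>, by a further factor \<open>a\<close>,
  and Cauchy-Schwarz bounds that component by the whole vector.\<close>
lemma gmetric_definite:
  assumes z: "z \<in> S3" and a: "0 < a" "a < 1" and v: "gmetric a z v v = 0"
  shows "v = 0"
proof -
  have "(v \<bullet> J z)\<^sup>2 \<le> (v \<bullet> v) * (J z \<bullet> J z)" by (rule Cauchy_Schwarz_ineq)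
  then have le: "(v \<bullet> J z)\<^sup>2 \<le> v \<bullet> v" by (simp add: J_inner S3_inner[OF z])
  have "a * (v \<bullet> v + (a - 1) * (v \<bullet> J z)\<^sup>2) = 0"
    using v by (simp add: gmetric_def eta0_def xi0_def power2_eq_square algebra_simps)
  then have "v \<bullet> v + (a - 1) * (v \<bullet> J z)\<^sup>2 = 0" using a by (metis mult_eq_0_iff less_irrefl)
  then have "v \<bullet> v = (1 - a) * (v \<bullet> J z)\<^sup>2" by (simp add: algebra_simps)
  also have "\<dots> \<le> (1 - a) * (v \<bullet> v)" using le a by (intro mult_left_mono) auto
  finally have "a * (v \<bullet> v) \<le> 0" by (simp add: algebra_simps)
  then have "v \<bullet> v = 0" using a inner_ge_zero[of v] by (simp add: mult_le_0_iff order_antisym)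
  then show "v = 0" by simp
qed

lemma gmetric_sym: "gmetric a z u v = gmetric a z v u"
  by (simp add: gmetric_def inner_commute mult.commute)

lemma gmetric_diff: "gmetric a z (u - u') v = gmetric a z u v - gmetric a z u' v"
  by (simp add: gmetric_def eta0_def inner_diff_left algebra_simps)

lemma levi_civita_torsion_free:
  assumes "levi_civita g D" "vfield X" "vfield Y" "z \<in> S3"
  shows "D X Y z - D Y X z = bracket X Y z"
  using assms unfolding levi_civita_def by blast

lemma levi_civita_metric:
  assumes "levi_civita g D" "vfield X" "vfield Y" "vfield Z" "z \<in> S3"
  shows "dd (\<lambda>x. g x (Y x) (Z x)) z (X z) = g z (D X Y z) (Z z) + g z (Y z) (D X Z z)"
  using assms unfolding levi_civita_def by blast

lemma levi_civita_vfield: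
  assumes "levi_civita g D" "vfield X" "vfield Y"
  shows "vfield (D X Y)"
proof -
  have "affine_connection D" using assms(1) by (simp add: levi_civita_def)
  then have "\<forall>X Y. vfield X \<longrightarrow> vfield Y \<longrightarrow> vfield (D X Y)"
    unfolding affine_connection_def by (rule conjunct1)
  then show ?thesis using assms by blast
qed

text \<open>The difference \<open>S\<close> of two Levi-Civita connections is symmetric because both are torsion free,
  and skew with respect to the metric in the last two slots because both are metric. A trilinear
  form that is symmetric in one pair of slots and skew in an overlapping pair vanishes; this is
  applied to the values at \<open>z\<close>, and definiteness finishes.\<close>
lemma levi_civita_unique:
  assumes D: "levi_civita (gmetric a) D" and D': "levi_civita (gmetric a) D'"
    and a: "0 < a" "a < 1" and X: "vfield X" and Y: "vfield Y" and z: "z \<in> S3"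
  shows "D X Y z = D' X Y z"
proof -
  define S where "S = (\<lambda>X Y. D X Y z - D' X Y z)"
  have sym: "S V W = S W V" if "vfield V" "vfield W" for V W
  proof -
    have "D V W z - D W V z = D' V W z - D' W V z"
      using levi_civita_torsion_free[OF D that z] levi_civita_torsion_free[OF D' that z] by simp
    then show ?thesis by (simp add: S_def algebra_simps)
  qed
  have skew: "gmetric a z (S V W) (U z) = - gmetric a z (S V U) (W z)"
    if "vfield V" "vfield W" "vfield U" for U V W
  proof -
    have "gmetric a z (D V W z) (U z) + gmetric a z (W z) (D V U z)
        = gmetric a z (D' V W z) (U z) + gmetric a z (W z) (D' V U z)"
      using levi_civita_metric[OF D that z] levi_civita_metric[OF D' that z] by simp
    then show ?thesis
      by (simp add: S_def gmetric_diff gmetric_sym[of a z "W z"])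
  qed
  have zero: "gmetric a z (S X Y) (Z z) = 0" if Z: "vfield Z" for Z
    using skew[OF X Y Z] skew[OF Y X Z] skew[OF Z X Y]
    unfolding sym[OF Y X] sym[OF Z X] sym[OF Z Y] by linarith
  have "z \<bullet> S X Y = 0"
    using levi_civita_vfield[OF D X Y] levi_civita_vfield[OF D' X Y] z
    by (simp add: S_def inner_diff_right vfield_def)
  then have "ext (S X Y) z = S X Y" by (simp add: ext_def tproj_id)
  then have "gmetric a z (S X Y) (S X Y) = 0" using zero[OF vfield_ext] by metis
  then have "S X Y = 0" by (rule gmetric_definite[OF z a])
  then show ?thesis by (simp add: S_def)
qed

text \<open>The connection \<open>nabla\<close>, which is specified only by a choice, thus becomes computable.\<close>
lemma nabla_eq_D0:
  assumes "0 < a" "a < 1" "vfield X" "vfield Y" "z \<in> S3"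
  shows "nabla (gmetric a) X Y z = D0 a X Y z"
  using levi_civita_unique[OF levi_civita_nabla levi_civita_D0 assms] .

lemma dd_ext: "dd (ext v) x w = - (w \<bullet> v) *\<^sub>R x - (x \<bullet> v) *\<^sub>R w"
  unfolding ext_def tproj_def
  by (rule fd_eq) (auto intro!: derivative_eq_intros)

text \<open>The tangential derivatives of the frame fields cancel in the sum: differentiating
  \<open>ext (axis i 1)\<close> along \<open>T\<close> gives \<open>- (z $ i) *\<^sub>R T\<close> after projection, and with the
  coefficients of \<open>V\<close> these terms add up to \<open>- (V s \<bullet> z) *\<^sub>R T = 0\<close>. What remains is the usual submanifold formula plus the
  tensor of the deformation.\<close>
lemma cov_nabla:
  assumes a: "0 < a" "a < 1" and z: "\<gamma> s \<in> S3" and T: "\<gamma> s \<bullet> velocity I \<gamma> s = 0"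
    and V: "\<gamma> s \<bullet> V s = 0"
  shows "cov (nabla (gmetric a)) I \<gamma> V s = tproj (\<gamma> s) (vector_derivative V (at s within I))
    + (1 - a) *\<^sub>R (eta0 (\<gamma> s) (velocity I \<gamma> s) *\<^sub>R phi0 (\<gamma> s) (V s)
                 + eta0 (\<gamma> s) (V s) *\<^sub>R phi0 (\<gamma> s) (velocity I \<gamma> s))"
proof -
  define z where "z = \<gamma> s"
  define T where "T = velocity I \<gamma> s"
  have zz: "z \<bullet> z = 1" and zT: "z \<bullet> T = 0" and zV: "z \<bullet> V s = 0"
    using z T V by (simp_all add: z_def T_def S3_inner)
  have extT: "ext T z = T" by (simp add: ext_def tproj_id zT)
  define e where "e = (\<lambda>i::4. ext (axis i 1) z)"
  have VE: "(\<Sum>i\<in>UNIV. (V s $ i) *\<^sub>R e i) = V s"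
    by (simp add: e_def sum_ext tproj_id zV)
  have lin: "linear (\<lambda>v. eta0 z T *\<^sub>R phi0 z v + eta0 z v *\<^sub>R phi0 z T)"
    by (rule linearI) (simp_all add: phi0_linear eta0_linear algebra_simps)
  have E: "nabla (gmetric a) (ext T) (ext (axis i 1)) z
      = - (z $ i) *\<^sub>R T + (1 - a) *\<^sub>R (eta0 z T *\<^sub>R phi0 z (e i) + eta0 z (e i) *\<^sub>R phi0 z T)" for i
  proof -
    have "tproj z (dd (ext (axis i 1)) z T) = - (z $ i) *\<^sub>R T"
      by (simp add: dd_ext tproj_def inner_diff_right zz zT inner_axis)
    then show ?thesis
      using a z by (simp add: nabla_eq_D0 vfield_ext z_def[symmetric] D0_def extT e_def)
  qed
  have "(\<Sum>i\<in>UNIV. (V s $ i) *\<^sub>R nabla (gmetric a) (ext T) (ext (axis i 1)) z)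
    = (\<Sum>i\<in>UNIV. (V s $ i) *\<^sub>R (- (z $ i) *\<^sub>R T
        + (1 - a) *\<^sub>R (eta0 z T *\<^sub>R phi0 z (e i) + eta0 z (e i) *\<^sub>R phi0 z T)))"
    by (simp only: E)
  also have "\<dots> = - (\<Sum>i\<in>UNIV. V s $ i * z $ i) *\<^sub>R T
      + (1 - a) *\<^sub>R (\<Sum>i\<in>UNIV. (V s $ i) *\<^sub>R (eta0 z T *\<^sub>R phi0 z (e i) + eta0 z (e i) *\<^sub>R phi0 z T))"
    by (simp add: algebra_simps sum.distrib sum_subtractf scaleR_sum_right scaleR_sum_left)
  also have "(\<Sum>i\<in>UNIV. V s $ i * z $ i) = 0"
    using zV by (simp add: inner_vec_def mult.commute)
  also have "(\<Sum>i\<in>UNIV. (V s $ i) *\<^sub>R (eta0 z T *\<^sub>R phi0 z (e i) + eta0 z (e i) *\<^sub>R phi0 z T))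
      = eta0 z T *\<^sub>R phi0 z (V s) + eta0 z (V s) *\<^sub>R phi0 z T"
    using linear_sum[OF lin, of "\<lambda>i. (V s $ i) *\<^sub>R e i" UNIV] by (simp add: VE linear_scale[OF lin])
  finally show ?thesis
    by (simp add: cov_def sum.distrib sum_ext z_def T_def)
qed

lemma bracket_ext: "bracket (ext u) (ext v) = (\<lambda>x. (x \<bullet> u) *\<^sub>R ext v x - (x \<bullet> v) *\<^sub>R ext u x)"
proof
  fix x :: R4
  have "ext u x \<bullet> v = ext v x \<bullet> u"
    by (simp add: ext_def tproj_def inner_diff_left inner_commute[of u v])
  then show "bracket (ext u) (ext v) x = (x \<bullet> u) *\<^sub>R ext v x - (x \<bullet> v) *\<^sub>R ext u x"
    by (simp add: bracket_def dd_ext)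
qed

text \<open>For a unit vector \<open>u\<close> of the metric (\<open>u \<bullet> u = 1 / a\<close>) the coefficient is \<open>4 / a - 3\<close> times
  \<open>k\<close>: this is the constant \<open>\<phi>\<close>-sectional curvature. Only the plane spanned by a horizontal \<open>u\<close>
  and \<open>J u\<close> matters for a Legendre curve. The inner derivatives \<open>\<nabla>\<^bsub>ext p\<^esub> (ext q)\<close> are replaced
  by an explicit field \<open>W p q\<close> agreeing with them on the sphere, which can then be differentiated
  once more; the bracket term drops out because the two extended fields commute at the base
  point (\<open>bracket_ext\<close>).\<close>
lemma curv_at_nabla:
  assumes a: "0 < a" "a < 1" and z: "z \<in> S3" and u: "z \<bullet> u = 0" and uz: "u \<bullet> J z = 0"
  shows "curv_at (nabla (gmetric a)) z u (k *\<^sub>R J u) u = - ((4 - 3 * a) * k * (u \<bullet> u)) *\<^sub>R J u"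
proof -
  define N where "N = nabla (gmetric a)"
  define v where "v = k *\<^sub>R J u"
  have zz: "z \<bullet> z = 1" using z by (rule S3_inner)
  have zu: "u \<bullet> z = 0" using u by (simp add: inner_commute)
  have zJu: "z \<bullet> J u = 0" using uz J_skew[of z u] by (simp add: inner_commute)
  have zv: "z \<bullet> v = 0" "v \<bullet> z = 0" using zJu by (simp_all add: v_def inner_commute)
  have vJz: "v \<bullet> J z = 0" by (simp add: v_def J_inner zu)
  have uJv: "u \<bullet> J v = - k * (u \<bullet> u)" using J_skew[of u v] by (simp add: v_def J_inner)
  have eu: "ext u z = u" and ev: "ext v z = v" by (simp_all add: ext_def tproj_id u zv)
  \<comment> \<open>On the sphere this is \<open>D0 a (ext p) (ext q)\<close> up to a normal component, written as a polynomial in the base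
    point; it vanishes at \<open>z\<close> when \<open>p\<close> and \<open>q\<close> are orthogonal to \<open>z\<close> and \<open>J z\<close>.\<close>
  define F where "F = (\<lambda>p q x. - (x \<bullet> q) *\<^sub>R p
      - (1 - a) *\<^sub>R ((p \<bullet> J x) *\<^sub>R (J q - (x \<bullet> q) *\<^sub>R J x) + (q \<bullet> J x) *\<^sub>R (J p - (x \<bullet> p) *\<^sub>R J x)))"
  have bJ: "bounded_linear J" using J_linear linear_conv_bounded_linear by blast
  have smF: "smooth (F p q)" for p q
    unfolding F_def
    by (intro smooth_diff smooth_add smooth_uminus smooth_scaleR smooth_inner smooth_const
        smooth_id smooth_J)
  define W where "W = (\<lambda>p q x. tproj x (F p q x))"
  have vW: "vfield (W p q)" for p q
    unfolding vfield_def
  proof (intro conjI ballI)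
    show "smooth (W p q)" unfolding W_def tproj_def
      by (intro smooth_diff smooth_scaleR smooth_inner smooth_id smF)
  qed (simp add: W_def tproj_tangent)
  have first: "N (ext p) (ext q) x = W p q x" if x: "x \<in> S3" for p q x
  proof -
    have xx: "x \<bullet> x = 1" using x by (rule S3_inner)
    have e: "eta0 x (ext r x) = - (r \<bullet> J x)" "phi0 x (ext r x) = tproj x (J r - (x \<bullet> r) *\<^sub>R J x)" for r
      by (simp_all add: eta0_def xi0_def ext_def tproj_def phi0_def J_diff J_scale inner_diff_left J_self)
    have d: "tproj x (dd (ext q) x (ext p x)) = tproj x (- (x \<bullet> q) *\<^sub>R p)"
    proof -
      have "tproj x x = 0" by (simp add: tproj_def xx)
      then show ?thesis
        by (simp add: dd_ext linear_diff[OF tproj_linear] linear_scale[OF tproj_linear]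
            linear_neg[OF tproj_linear])
           (simp add: ext_def linear_diff[OF tproj_linear] linear_scale[OF tproj_linear] tproj_def
             inner_diff_right xx)
    qed
    show ?thesis
      unfolding N_def nabla_eq_D0[OF a vfield_ext vfield_ext x] D0_def d e W_def F_def
      by (simp add: linear_add[OF tproj_linear] linear_diff[OF tproj_linear]
          linear_scale[OF tproj_linear] linear_neg[OF tproj_linear] algebra_simps)
  qed
  have second: "N X (N (ext p) (ext q)) z = D0 a X (W p q) z" if X: "vfield X" for X p q
  proof -
    have vN: "vfield (N (ext p) (ext q))"
      unfolding N_def by (rule levi_civita_vfield[OF levi_civita_nabla vfield_ext vfield_ext])
    have aN: "affine_connection N"
      using levi_civita_nabla unfolding N_def levi_civita_def by blast
    have "N X (N (ext p) (ext q)) z = N X (W p q) z"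
      by (rule D_cong[OF aN X X vN vW refl first z])
    also have "\<dots> = D0 a X (W p q) z" unfolding N_def by (rule nabla_eq_D0[OF a X vW z])
    finally show ?thesis .
  qed
  have dF: "dd (F p q) z w = - (w \<bullet> q) *\<^sub>R p
      - (1 - a) *\<^sub>R ((p \<bullet> J w) *\<^sub>R J q + (q \<bullet> J w) *\<^sub>R J p)"
    if "z \<bullet> p = 0" "z \<bullet> q = 0" "p \<bullet> J z = 0" "q \<bullet> J z = 0" for p q w
    unfolding F_def
    by (rule fd_eq) (auto intro!: derivative_eq_intros bounded_linear.has_derivative[OF bJ]
        simp: that)
  have F0: "F p q z = 0" if "z \<bullet> p = 0" "z \<bullet> q = 0" "p \<bullet> J z = 0" "q \<bullet> J z = 0" for p q
    by (simp add: F_def that)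
  have dW: "tproj z (dd (W p q) z w) = tproj z (dd (F p q) z w)"
    if "z \<bullet> p = 0" "z \<bullet> q = 0" "p \<bullet> J z = 0" "q \<bullet> J z = 0" for p q w
  proof -
    have "dd (W p q) z w = dd (F p q) z w - ((z \<bullet> dd (F p q) z w) *\<^sub>R z)"
      unfolding W_def tproj_def
      by (rule fd_eq) (auto intro!: derivative_eq_intros smooth_has[OF smF]
        simp: F0[OF that])
    then show ?thesis by (simp add: tproj_def inner_diff_right zz)
  qed
  have D: "D0 a X (W p q) z = tproj z (- (X z \<bullet> q) *\<^sub>R p
      - (1 - a) *\<^sub>R ((p \<bullet> J (X z)) *\<^sub>R J q + (q \<bullet> J (X z)) *\<^sub>R J p))"
    if "z \<bullet> p = 0" "z \<bullet> q = 0" "p \<bullet> J z = 0" "q \<bullet> J z = 0" "X z \<bullet> J z = 0" for X p q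
  proof -
    have "W p q z = 0" by (simp add: W_def F0 that tproj_def)
    then show ?thesis
      using that by (simp add: D0_def dW dF eta0_def xi0_def)
  qed
  have Y: "N (ext u) (N (ext v) (ext u)) z = - (k * (2 - a) * (u \<bullet> u)) *\<^sub>R J u"
  proof -
    have "- (u \<bullet> u) *\<^sub>R v - (1 - a) *\<^sub>R ((v \<bullet> J u) *\<^sub>R J u + (u \<bullet> J u) *\<^sub>R J v)
        = - (k * (2 - a) * (u \<bullet> u)) *\<^sub>R J u"
      by (simp add: v_def J_self J_inner vec_eq_iff algebra_simps)
    then show ?thesis
      unfolding second[OF vfield_ext] D[OF zv(1) u vJz uz, of "ext u", unfolded eu, OF uz]
      by (simp add: tproj_def zJu)
  qed
  have vu: "v \<bullet> u = 0" by (simp add: v_def J_self)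
  have "- (v \<bullet> u) *\<^sub>R u - (1 - a) *\<^sub>R ((u \<bullet> J v) *\<^sub>R J u + (u \<bullet> J v) *\<^sub>R J u)
      = (2 * (1 - a) * k * (u \<bullet> u)) *\<^sub>R J u"
    unfolding vu uJv by (simp add: vec_eq_iff algebra_simps)
  then have X: "N (ext v) (N (ext u) (ext u)) z = (2 * (1 - a) * k * (u \<bullet> u)) *\<^sub>R J u"
    unfolding second[OF vfield_ext] D[OF u u uz uz, of "ext v", unfolded ev, OF vJz]
    by (simp add: tproj_def zJu)
  have B: "N (bracket (ext u) (ext v)) (ext u) z = 0"
  proof -
    have "vfield (bracket (ext u) (ext v))"
      unfolding bracket_ext vfield_def
      using vfield_ext[of u] vfield_ext[of v]
      by (auto simp: inner_diff_right vfield_def intro!: smooth_diff smooth_scaleR smooth_inner smooth_id smooth_const)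
    moreover have "bracket (ext u) (ext v) z = 0" by (simp add: bracket_ext u zv)
    moreover have "linear (dd (ext u) z)" using vfield_ext[of u] by (simp add: vfield_def dd_linear)
    ultimately show ?thesis
      unfolding N_def
      by (simp add: nabla_eq_D0[OF a _ vfield_ext z] D0_def linear_0 eta0_def phi0_def tproj_def
          linear_0[OF J_linear])
  qed
  show ?thesis
    unfolding curv_at_def curv_def v_def[symmetric] N_def[symmetric] X Y B
    by (simp add: vec_eq_iff) (simp add: algebra_simps)
qed

section \<open>The frame of a Legendre curve\<close>

lemma J_J: "J (J x) = - x"
  by (simp add: vec_eq_iff forall_4)

text \<open>A nonzero remainder of the expansion would be orthogonal to all of \<open>z\<close>, \<open>J z\<close>, \<open>t\<close>, \<open>J t\<close>,
  giving five independent vectors in dimension four.\<close>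
lemma S3_frame_expansion:
  fixes v z t :: R4
  assumes z: "z \<bullet> z = 1" and t: "t \<bullet> t = r" "0 < r" and zt: "z \<bullet> t = 0" and tJz: "t \<bullet> J z = 0"
  shows "v = (v \<bullet> z) *\<^sub>R z + (v \<bullet> J z) *\<^sub>R J z + ((v \<bullet> t) / r) *\<^sub>R t + ((v \<bullet> J t) / r) *\<^sub>R J t"
proof (rule ccontr)
  define w where "w = v - ((v \<bullet> z) *\<^sub>R z + (v \<bullet> J z) *\<^sub>R J z + ((v \<bullet> t) / r) *\<^sub>R t + ((v \<bullet> J t) / r) *\<^sub>R J t)"
  assume "\<not> ?thesis"
  then have "w \<noteq> 0" by (simp add: w_def)
  have zJt: "z \<bullet> J t = 0" using tJz J_skew[of z t] by (simp add: inner_commute)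
  have o: "z \<bullet> J z = 0" "J z \<bullet> z = 0" "t \<bullet> J t = 0" "J t \<bullet> t = 0" "z \<bullet> t = 0" "t \<bullet> z = 0"
    "z \<bullet> J t = 0" "J t \<bullet> z = 0" "t \<bullet> J z = 0" "J z \<bullet> t = 0" "J z \<bullet> J t = 0" "J t \<bullet> J z = 0"
    using J_self[of z] J_self[of t] zt tJz zJt by (simp_all add: J_inner inner_commute)
  have n: "J z \<bullet> J z = 1" "J t \<bullet> J t = r" using z t by (simp_all add: J_inner)
  have wo: "w \<bullet> z = 0" "w \<bullet> J z = 0" "w \<bullet> t = 0" "w \<bullet> J t = 0"
    using t by (simp_all add: w_def inner_diff_left inner_add_left o n z)
  have nz: "z \<noteq> 0" "J z \<noteq> 0" "t \<noteq> 0" "J t \<noteq> 0"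
    using z t n by (metis inner_zero_left less_irrefl zero_neq_one)+
  let ?S = "{w, z, J z, t, J t}"
  have ne: "x \<noteq> y" if "x \<bullet> y = 0" "x \<noteq> 0" for x y :: R4
    using that by auto
  have "card ?S = 5"
    using ne[OF wo(1)] ne[OF wo(2)] ne[OF wo(3)] ne[OF wo(4)] ne[OF o(1)] ne[OF o(5)] ne[OF o(7)]
      ne[OF o(10)] ne[OF o(11)] ne[OF o(3)] \<open>w \<noteq> 0\<close> nz by simp
  moreover have "pairwise orthogonal ?S"
    using o wo by (auto simp: pairwise_def orthogonal_def inner_commute)
  then have "independent ?S"
    using \<open>w \<noteq> 0\<close> nz by (intro pairwise_orthogonal_independent) auto
  then have "card ?S \<le> DIM(R4)" by (rule independent_bound[THEN conjunct2])
  ultimately show False by simp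
qed

text \<open>This makes one-sided derivatives along \<open>I\<close> unique.\<close>
lemma interval_not_isolated:
  fixes I :: "real set"
  assumes "is_interval I" "interior I \<noteq> {}" "s \<in> I"
  shows "at s within I \<noteq> bot"
proof -
  have "connected I" using assms by (simp add: is_interval_connected)
  moreover have "I \<noteq> {s}" using assms(2) by (metis interior_singleton)
  ultimately show ?thesis
    using connected_imp_perfect[of I s] assms(3) by (auto simp: trivial_limit_within)
qed

text \<open>Here \<open>d n\<close> is the \<open>n\<close>-th derivative of the curve. Having the whole family as a parameter avoids
  iterating one-sided derivatives at the end points of \<open>I\<close>.\<close>
locale legendre_curve =
  fixes a :: real and I :: "real set" and \<gamma> :: "real \<Rightarrow> R4" and d :: "nat \<Rightarrow> real \<Rightarrow> R4"
  assumes a: "0 < a" "a < 1"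
    and I: "is_interval I" "interior I \<noteq> {}"
    and d0: "\<And>s. s \<in> I \<Longrightarrow> d 0 s = \<gamma> s"
    and dn: "\<And>n s. s \<in> I \<Longrightarrow> (d n has_vector_derivative d (Suc n) s) (at s within I)"
    and S3: "\<gamma> ` I \<subseteq> S3"
    and leg: "legendre a I \<gamma>" and arc: "arc_length_param (gmetric a) I \<gamma>"
begin

abbreviation "T \<equiv> d (Suc 0)"

lemma vector_derivative_eqI:
  assumes s: "s \<in> I" and f: "(f has_vector_derivative f') (at s within I)"
    and e: "\<And>t. t \<in> I \<Longrightarrow> g t = f t"
  shows "vector_derivative g (at s within I) = f'"
  using has_vector_derivative_transform[OF s e f] interval_not_isolated[OF I s]
  by (intro vector_derivative_within)

lemma derivative_of_const:
  fixes f :: "real \<Rightarrow> real"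
  assumes s: "s \<in> I" and f: "(f has_vector_derivative f') (at s within I)"
    and c: "\<And>t. t \<in> I \<Longrightarrow> f t = c"
  shows "f' = 0"
  using vector_derivative_eqI[OF s f, of "\<lambda>_. c"] c
    vector_derivative_eqI[OF s has_vector_derivative_const, of "\<lambda>_. c" c] by simp

lemma inner_derivative:
  fixes f g :: "real \<Rightarrow> R4"
  assumes "(f has_vector_derivative f') (at s within I)" "(g has_vector_derivative g') (at s within I)"
  shows "((\<lambda>t. f t \<bullet> g t) has_vector_derivative (f s \<bullet> g' + f' \<bullet> g s)) (at s within I)"
  using bounded_bilinear.has_vector_derivative[OF bounded_bilinear_inner assms] .

lemma J_derivative:
  assumes "(f has_vector_derivative f') (at s within I)"
  shows "((\<lambda>t. J (f t)) has_vector_derivative J f') (at s within I)"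
  using bounded_linear.has_vector_derivative[OF _ assms] J_linear linear_conv_bounded_linear by blast

lemma \<gamma>_derivative: "s \<in> I \<Longrightarrow> (\<gamma> has_vector_derivative T s) (at s within I)"
  using has_vector_derivative_transform[OF _ _ dn, of s \<gamma>] d0 by simp

lemma velocity_eq: "s \<in> I \<Longrightarrow> velocity I \<gamma> s = T s"
  unfolding velocity_def by (rule vector_derivative_eqI[OF _ \<gamma>_derivative]) auto

text \<open>Along the curve \<open>\<gamma>\<close>, \<open>J \<gamma>\<close>, \<open>T\<close>, \<open>J T\<close> are mutually orthogonal, so Legendre curves come
  with their own Frenet frame \<open>T\<close>, \<open>J T\<close>, \<open>- J \<gamma> / a\<close> of the deformed metric.\<close>
lemma frame:
  assumes s: "s \<in> I"
  shows "\<gamma> s \<in> S3" "\<gamma> s \<bullet> \<gamma> s = 1" "\<gamma> s \<bullet> T s = 0" "T s \<bullet> J (\<gamma> s) = 0" "T s \<bullet> T s = 1 / a"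
    "\<gamma> s \<bullet> J (T s) = 0"
proof -
  have 1: "\<gamma> t \<bullet> \<gamma> t = 1" if "t \<in> I" for t using S3 that S3_inner by blast
  show "\<gamma> s \<in> S3" using S3 s by blast
  show "\<gamma> s \<bullet> \<gamma> s = 1" by (rule 1[OF s])
  show "\<gamma> s \<bullet> T s = 0"
    using derivative_of_const[OF s inner_derivative[OF \<gamma>_derivative[OF s] \<gamma>_derivative[OF s]] 1]
    by (simp add: inner_commute)
  show 2: "T s \<bullet> J (\<gamma> s) = 0"
    using leg s a by (auto simp: legendre_def eta_def eta0_def xi0_def velocity_eq)
  show "T s \<bullet> T s = 1 / a"
    using arc s a 2 by (auto simp: arc_length_param_def gmetric_def eta0_def xi0_def velocity_eq field_simps)
  show "\<gamma> s \<bullet> J (T s) = 0" using 2 J_skew[of "\<gamma> s" "T s"] by (simp add: inner_commute)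
qed

text \<open>The signed geodesic curvature with respect to the normal \<open>J T\<close>, and its first two
  derivatives. The factor \<open>a\<close> appears because the deformed metric is \<open>a\<close> times the Euclidean one
  on vectors orthogonal to \<open>J \<gamma>\<close>; the derivative of \<open>\<kappa>\<close> has no term \<open>d 2 s \<bullet> J (d 2 s)\<close>, as that product is zero.\<close>
definition \<kappa> :: "real \<Rightarrow> real" where "\<kappa> s = a * (d 2 s \<bullet> J (T s))"
definition \<kappa>' :: "real \<Rightarrow> real" where "\<kappa>' s = a * (d 3 s \<bullet> J (T s))"
definition \<kappa>'' :: "real \<Rightarrow> real" where "\<kappa>'' s = a * (d 3 s \<bullet> J (d 2 s) + d 4 s \<bullet> J (T s))"

lemma T_derivative: "s \<in> I \<Longrightarrow> (T has_vector_derivative d 2 s) (at s within I)"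
  using dn[of s 1] by (simp add: numeral_2_eq_2)

lemma \<kappa>_derivative:
  assumes s: "s \<in> I"
  shows "(\<kappa> has_vector_derivative \<kappa>' s) (at s within I)"
  unfolding \<kappa>_def[abs_def] \<kappa>'_def
  using has_vector_derivative_mult_right[OF inner_derivative[OF dn[of s 2] J_derivative[OF T_derivative]], of a] s
  by (simp add: J_self eval_nat_numeral)

lemma \<kappa>'_derivative:
  assumes s: "s \<in> I"
  shows "(\<kappa>' has_vector_derivative \<kappa>'' s) (at s within I)"
  unfolding \<kappa>'_def[abs_def] \<kappa>''_def
  using has_vector_derivative_mult_right[OF inner_derivative[OF dn[of s 3] J_derivative[OF T_derivative]], of a] s
  by (simp add: eval_nat_numeral)

text \<open>Differentiating \<open>\<gamma> \<bullet> T = 0\<close>, \<open>T \<bullet> J \<gamma> = 0\<close> and \<open>T \<bullet> T = 1 / a\<close> determines three of the four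
  frame components of the Euclidean acceleration, leaving only the curvature free.\<close>
lemma acceleration:
  assumes s: "s \<in> I"
  shows "d 2 s = - (1 / a) *\<^sub>R \<gamma> s + \<kappa> s *\<^sub>R J (T s)"
proof -
  note f = frame[OF s]
  note T' = T_derivative[OF s] and g' = \<gamma>_derivative[OF s]
  have 1: "d 2 s \<bullet> \<gamma> s = - 1 / a"
    using derivative_of_const[OF s inner_derivative[OF g' T'] frame(3)] f
    by (simp add: inner_commute)
  have 2: "d 2 s \<bullet> J (\<gamma> s) = 0"
    using derivative_of_const[OF s inner_derivative[OF T' J_derivative[OF g']] frame(4)]
    by (simp add: J_self)
  have 3: "d 2 s \<bullet> T s = 0"
    using derivative_of_const[OF s inner_derivative[OF T' T'] frame(5)]
    by (simp add: inner_commute)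
  show ?thesis
    using S3_frame_expansion[OF f(2) f(5) _ f(3) f(4), of "d 2 s"] a
    by (simp add: 1 2 3 \<kappa>_def mult.commute)
qed

text \<open>As \<open>eta0 (\<gamma> s) (T s) = 0\<close> and \<open>J (T s)\<close> is already tangent, only the vertical component of the
  field meets the tensor of the deformation.\<close>
lemma cov_along:
  assumes s: "s \<in> I" and V: "\<gamma> s \<bullet> W s = 0" and W: "(W has_vector_derivative W') (at s within I)"
    and e: "\<And>t. t \<in> I \<Longrightarrow> V t = W t"
  shows "cov (nabla (gmetric a)) I \<gamma> V s
    = W' - (\<gamma> s \<bullet> W') *\<^sub>R \<gamma> s - ((1 - a) * (W s \<bullet> J (\<gamma> s))) *\<^sub>R J (T s)"
proof -
  note f = frame[OF s]
  show ?thesis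
    using cov_nabla[where V=V and I=I and \<gamma>=\<gamma> and s=s, OF a f(1)] V f
    by (simp add: velocity_eq s e vector_derivative_eqI[OF s W e] tproj_def eta0_def xi0_def phi0_def)
qed

text \<open>The Frenet computation follows. It amounts to \<open>\<nabla>\<^sub>T T = \<kappa> J T\<close>,
  \<open>\<nabla>\<^sub>T (J T) = \<xi> - \<kappa> T\<close> and \<open>\<nabla>\<^sub>T \<xi> = - J T\<close> with \<open>\<xi> = - J \<gamma> / a\<close>, which
  are the Frenet equations of a curve with torsion 1.\<close>
lemma tension_eq:
  assumes s: "s \<in> I"
  shows "cov (nabla (gmetric a)) I \<gamma> (velocity I \<gamma>) s = \<kappa> s *\<^sub>R J (T s)"
  using cov_along[OF s frame(3)[OF s] T_derivative[OF s] velocity_eq] frame[OF s]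
  by (simp add: acceleration[OF s] inner_add_right inner_diff_right)

lemma J_acceleration: "s \<in> I \<Longrightarrow> J (d 2 s) = - (1 / a) *\<^sub>R J (\<gamma> s) - \<kappa> s *\<^sub>R T s"
  by (simp add: acceleration J_add J_diff J_scale J_J)

lemma cov2_eq:
  assumes s: "s \<in> I"
  shows "cov (nabla (gmetric a)) I \<gamma> (cov (nabla (gmetric a)) I \<gamma> (velocity I \<gamma>)) s
    = \<kappa>' s *\<^sub>R J (T s) - (\<kappa> s / a) *\<^sub>R J (\<gamma> s) - (\<kappa> s)\<^sup>2 *\<^sub>R T s"
proof -
  note f = frame[OF s]
  have "((\<lambda>t. \<kappa> t *\<^sub>R J (T t)) has_vector_derivative (\<kappa> s *\<^sub>R J (d 2 s) + \<kappa>' s *\<^sub>R J (T s))) (at s within I)"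
    using \<kappa>_derivative[OF s]
    by (intro has_vector_derivative_scaleR J_derivative T_derivative s)
       (simp add: has_real_derivative_iff_has_vector_derivative)
  from cov_along[OF s _ this tension_eq] show ?thesis
    using f by (simp add: J_acceleration[OF s] J_inner J_self inner_add_right inner_diff_right
        inner_commute[of "T s" "\<gamma> s"] algebra_simps power2_eq_square)
qed

lemma bitension_eq:
  assumes s: "s \<in> I"
  shows "bitension (gmetric a) I \<gamma> s
    = (\<kappa>'' s + \<kappa> s * (4 / a - 4 - (\<kappa> s)\<^sup>2)) *\<^sub>R J (T s) - (2 * \<kappa>' s / a) *\<^sub>R J (\<gamma> s) - (3 * \<kappa> s * \<kappa>' s) *\<^sub>R T s"
proof -
  note f = frame[OF s]
  define W where "W = (\<lambda>t. \<kappa>' t *\<^sub>R J (T t) - (\<kappa> t * (1 / a)) *\<^sub>R J (\<gamma> t) - (\<kappa> t * \<kappa> t) *\<^sub>R T t)"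
  have \<kappa>: "(\<kappa> has_real_derivative \<kappa>' s) (at s within I)" "(\<kappa>' has_real_derivative \<kappa>'' s) (at s within I)"
    using \<kappa>_derivative[OF s] \<kappa>'_derivative[OF s]
    by (simp_all add: has_real_derivative_iff_has_vector_derivative)
  \<comment> \<open>\<open>W\<close> is the second covariant derivative of \<open>T\<close> and \<open>X\<close> its Euclidean derivative. The vertical
    part of \<open>W\<close> makes the deformation add \<open>(1 - a) * \<kappa> s / a\<close> to the coefficient
    \<open>- \<kappa> s / a\<close> of \<open>J (T s)\<close> in \<open>X\<close>, which turns it into \<open>- \<kappa> s\<close>.\<close>
  define X where "X = (\<kappa>' s *\<^sub>R J (d 2 s) + \<kappa>'' s *\<^sub>R J (T s))
      - ((\<kappa> s * (1 / a)) *\<^sub>R J (T s) + (\<kappa>' s * (1 / a)) *\<^sub>R J (\<gamma> s))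
      - ((\<kappa> s * \<kappa> s) *\<^sub>R d 2 s + (\<kappa> s * \<kappa>' s + \<kappa>' s * \<kappa> s) *\<^sub>R T s)"
  have W: "(W has_vector_derivative X) (at s within I)"
    unfolding W_def X_def
    by (intro has_vector_derivative_diff has_vector_derivative_scaleR DERIV_cmult_right DERIV_mult' \<kappa>
        J_derivative T_derivative \<gamma>_derivative s)
  have X: "X = ((\<kappa> s)\<^sup>2 / a) *\<^sub>R \<gamma> s + (\<kappa>'' s - \<kappa> s / a - \<kappa> s ^ 3) *\<^sub>R J (T s)
      - (2 * \<kappa>' s / a) *\<^sub>R J (\<gamma> s) - (3 * \<kappa> s * \<kappa>' s) *\<^sub>R T s"
    unfolding X_def J_acceleration[OF s] unfolding acceleration[OF s] using a
    by (simp add: vec_eq_iff) (simp add: field_simps power2_eq_square power3_eq_cube)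
  have gX: "\<gamma> s \<bullet> X = (\<kappa> s)\<^sup>2 / a"
    using f by (simp add: X inner_add_right inner_diff_right J_self)
  have e: "cov (nabla (gmetric a)) I \<gamma> (cov (nabla (gmetric a)) I \<gamma> (velocity I \<gamma>)) t = W t"
    if "t \<in> I" for t
    using cov2_eq[OF that] by (simp add: W_def power2_eq_square)
  have W0: "\<gamma> s \<bullet> W s = 0" "W s \<bullet> J (\<gamma> s) = - \<kappa> s / a"
    using f by (simp_all add: W_def inner_diff_right inner_diff_left J_self J_inner
        inner_commute[of "T s" "\<gamma> s"])
  have c3: "cov (nabla (gmetric a)) I \<gamma> (cov (nabla (gmetric a)) I \<gamma>
        (cov (nabla (gmetric a)) I \<gamma> (velocity I \<gamma>))) s
      = (\<kappa>'' s - \<kappa> s - \<kappa> s ^ 3) *\<^sub>R J (T s) - (2 * \<kappa>' s / a) *\<^sub>R J (\<gamma> s) - (3 * \<kappa> s * \<kappa>' s) *\<^sub>R T s"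
    using cov_along[where V = "cov (nabla (gmetric a)) I \<gamma> (cov (nabla (gmetric a)) I \<gamma> (velocity I \<gamma>))"
        and W = W, OF s W0(1) W e] a
    by (simp add: gX W0(2)) (simp add: X vec_eq_iff, simp add: field_simps)
  have cu: "curv_at (nabla (gmetric a)) (\<gamma> s) (T s) (\<kappa> s *\<^sub>R J (T s)) (T s)
      = - ((4 / a - 3) * \<kappa> s) *\<^sub>R J (T s)"
    unfolding curv_at_nabla[OF a f(1) f(3) f(4)] f(5) using a by (simp add: field_simps)
  show ?thesis
    unfolding bitension_def velocity_eq[OF s] tension_eq[OF s] c3 cu
    by (simp add: vec_eq_iff) (simp add: algebra_simps power3_eq_cube power2_eq_square)
qed

text \<open>The component of \<open>bitension_eq\<close> along \<open>J \<gamma>\<close> forces the curvature to be constant; the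
  component along \<open>J T\<close> then says that it is zero (a geodesic) or has the square \<open>4 / a - 4\<close>, which
  is positive as \<open>a < 1\<close>.\<close>
lemma proper_biharmonic_iff:
  "proper_biharmonic (gmetric a) I \<gamma> \<longleftrightarrow> (\<exists>c. c\<^sup>2 = 4 / a - 4 \<and> (\<forall>s\<in>I. \<kappa> s = c))"
proof
  assume R: "proper_biharmonic (gmetric a) I \<gamma>"
  then have b: "bitension (gmetric a) I \<gamma> s = 0" if "s \<in> I" for s
    using that by (simp add: proper_biharmonic_def biharmonic_def)
  have \<kappa>': "\<kappa>' s = 0" if s: "s \<in> I" for s
  proof -
    note f = frame[OF s]
    have "bitension (gmetric a) I \<gamma> s \<bullet> J (\<gamma> s) = - (2 * \<kappa>' s / a)"
      using f unfolding bitension_eq[OF s]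
      by (simp add: inner_diff_left J_inner inner_commute[of "T s" "\<gamma> s"])
    then show ?thesis using b[OF s] a by simp
  qed
  have \<kappa>'': "\<kappa>'' s = 0" if s: "s \<in> I" for s
    using derivative_of_const[OF s \<kappa>'_derivative[OF s] \<kappa>'] .
  obtain c where c: "\<And>s. s \<in> I \<Longrightarrow> \<kappa> s = c"
    using has_vector_derivative_zero_constant[of I \<kappa>] \<kappa>_derivative \<kappa>' I
    by (auto simp: is_interval_convex)
  obtain s where s: "s \<in> I" and "tension (gmetric a) I \<gamma> s \<noteq> 0"
    using R by (auto simp: proper_biharmonic_def harmonic_def)
  then have "c \<noteq> 0" by (auto simp: tension_def tension_eq c)
  have "J (T s) \<noteq> 0" using frame(5)[OF s] J_inner[of "T s" "T s"] a by auto
  then have "c\<^sup>2 = 4 / a - 4"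
    using b[OF s] unfolding bitension_eq[OF s] using \<open>c \<noteq> 0\<close> by (simp add: \<kappa>' \<kappa>'' c s)
  with c show "\<exists>c. c\<^sup>2 = 4 / a - 4 \<and> (\<forall>s\<in>I. \<kappa> s = c)" by blast
next
  assume "\<exists>c. c\<^sup>2 = 4 / a - 4 \<and> (\<forall>s\<in>I. \<kappa> s = c)"
  then obtain c where c2: "c\<^sup>2 = 4 / a - 4" and c: "\<And>s. s \<in> I \<Longrightarrow> \<kappa> s = c" by blast
  have \<kappa>': "\<kappa>' s = 0" if s: "s \<in> I" for s
    using derivative_of_const[OF s \<kappa>_derivative[OF s] c] .
  have \<kappa>'': "\<kappa>'' s = 0" if s: "s \<in> I" for s
    using derivative_of_const[OF s \<kappa>'_derivative[OF s] \<kappa>'] .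
  have "biharmonic (gmetric a) I \<gamma>"
    unfolding biharmonic_def by (simp add: bitension_eq \<kappa>' \<kappa>'' c c2)
  moreover obtain s where s: "s \<in> I" using I(2) interior_subset by blast
  have "c \<noteq> 0" using c2 a by (auto simp: field_simps)
  then have "tension (gmetric a) I \<gamma> s \<noteq> 0"
    using frame(5)[OF s] J_inner[of "T s" "T s"] a s by (auto simp: tension_def tension_eq c)
  ultimately show "proper_biharmonic (gmetric a) I \<gamma>"
    using s by (auto simp: proper_biharmonic_def harmonic_def)
qed

end

section \<open>The complex linear equation\<close>

text \<open>Multiplication by \<open>exp (\<i> \<theta>)\<close> when \<open>J\<close> is read as multiplication by \<open>\<i>\<close>.\<close>
definition rot :: "real \<Rightarrow> R4 \<Rightarrow> R4" where
  "rot \<theta> v = cos \<theta> *\<^sub>R v + sin \<theta> *\<^sub>R J v"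

lemma rot_rot: "rot \<alpha> (rot \<beta> v) = rot (\<alpha> + \<beta>) v"
  by (simp add: rot_def J_add J_scale J_J vec_eq_iff) (simp add: cos_add sin_add algebra_simps)

lemma rot_0: "rot 0 v = v"
  by (simp add: rot_def)

lemma rot_scale: "rot \<theta> (c *\<^sub>R v) = c *\<^sub>R rot \<theta> v"
  by (simp add: rot_def J_scale scaleR_add_right mult.commute)

lemma rot_minus: "rot \<theta> (- v) = - rot \<theta> v"
  using rot_scale[of \<theta> "-1" v] by simp

lemma rot_J: "rot \<theta> (J v) = J (rot \<theta> v)"
  by (simp add: rot_def J_add J_scale)

lemma inner_rot_self: "rot \<theta> v \<bullet> rot \<theta> v = v \<bullet> v"
proof -
  have "rot \<theta> v \<bullet> rot \<theta> v = ((cos \<theta>)\<^sup>2 + (sin \<theta>)\<^sup>2) * (v \<bullet> v)"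
    unfolding rot_def
    by (simp only: inner_add_left inner_add_right inner_scaleR_left inner_scaleR_right J_self J_inner)
       algebra
  then show ?thesis by simp
qed

lemma inner_rot_orthogonal:
  assumes "u \<bullet> v = 0" "u \<bullet> J v = 0"
  shows "rot \<alpha> u \<bullet> rot \<beta> v = 0"
  using assms J_skew[of u v] by (simp add: rot_def inner_add_left inner_add_right J_inner)

lemma rot_derivative:
  assumes "(f has_vector_derivative f') (at s within I)"
  shows "((\<lambda>t. rot (\<mu> * t) (f t)) has_vector_derivative rot (\<mu> * s) (f' + \<mu> *\<^sub>R J (f s))) (at s within I)"
proof -
  have bJ: "bounded_linear J" using J_linear linear_conv_bounded_linear by blast
  have J: "((\<lambda>t. J (f t)) has_vector_derivative J f') (at s within I)"
    by (rule bounded_linear.has_vector_derivative[OF bJ assms])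
  have c: "((\<lambda>t. cos (\<mu> * t)) has_real_derivative - (\<mu> * sin (\<mu> * s))) (at s within I)"
    and s: "((\<lambda>t. sin (\<mu> * t)) has_real_derivative \<mu> * cos (\<mu> * s)) (at s within I)"
    by (auto intro!: derivative_eq_intros)
  have "((\<lambda>t. rot (\<mu> * t) (f t)) has_vector_derivative
      (cos (\<mu> * s) *\<^sub>R f' + - (\<mu> * sin (\<mu> * s)) *\<^sub>R f s)
      + (sin (\<mu> * s) *\<^sub>R J f' + (\<mu> * cos (\<mu> * s)) *\<^sub>R J (f s))) (at s within I)"
    unfolding rot_def
    by (intro has_vector_derivative_add has_vector_derivative_scaleR c s J assms)
  moreover have "(cos (\<mu> * s) *\<^sub>R f' + - (\<mu> * sin (\<mu> * s)) *\<^sub>R f s)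
      + (sin (\<mu> * s) *\<^sub>R J f' + (\<mu> * cos (\<mu> * s)) *\<^sub>R J (f s))
      = rot (\<mu> * s) (f' + \<mu> *\<^sub>R J (f s))"
    by (simp add: rot_def J_add J_scale J_J vec_eq_iff) (simp add: algebra_simps)
  ultimately show ?thesis by simp
qed

text \<open>Undoing the rotation turns a solution into a constant.\<close>
lemma J_ode_unique:
  fixes I :: "real set"
  assumes I: "convex I"
    and p: "\<And>s. s \<in> I \<Longrightarrow> (p has_vector_derivative \<mu> *\<^sub>R J (p s)) (at s within I)"
  obtains c where "\<And>s. s \<in> I \<Longrightarrow> p s = rot (\<mu> * s) c"
proof -
  have "((\<lambda>t. rot (- \<mu> * t) (p t)) has_vector_derivative 0) (at s within I)" if "s \<in> I" for s
    using rot_derivative[OF p[OF that], of "- \<mu>"] by (simp add: rot_def linear_0[OF J_linear])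
  then obtain c where c: "\<And>s. s \<in> I \<Longrightarrow> rot (- \<mu> * s) (p s) = c"
    using has_vector_derivative_zero_constant[OF I] by blast
  have "p s = rot (\<mu> * s) c" if "s \<in> I" for s
    using c[OF that] by (auto simp: rot_rot rot_0)
  then show ?thesis by (rule that)
qed

context legendre_curve
begin

text \<open>With constant curvature \<open>B - A\<close> and \<open>A * B = 1 / a\<close>, the Gauss formula \<open>acceleration\<close> reads
  \<open>\<gamma>'' - (B - A) J \<gamma>' + A B \<gamma> = 0\<close>, whose characteristic roots are \<open>- A J\<close> and \<open>B J\<close>. The components
  of \<open>\<gamma>\<close> in the two eigenspaces, \<open>p\<close> and \<open>q\<close>, are combinations of \<open>\<gamma>\<close> and \<open>J T\<close>; the
  relations in \<open>frame\<close> give their lengths and show that they are orthogonal over the complex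
  numbers. Negative \<open>A\<close> and \<open>B\<close> correspond to the opposite orientation.\<close>
lemma constant_curvature_imp_helix:
  assumes AB: "A * B = 1 / a" "A + B \<noteq> 0" and \<kappa>: "\<And>s. s \<in> I \<Longrightarrow> \<kappa> s = B - A"
  obtains e1 e3 where "norm e1 = 1" "norm e3 = 1" "e1 \<bullet> e3 = 0" "e3 \<bullet> J e1 = 0"
    "\<And>s. s \<in> I \<Longrightarrow> \<gamma> s = rot (- A * s) (sqrt (B / (A + B)) *\<^sub>R e1) + rot (B * s) (sqrt (A / (A + B)) *\<^sub>R e3)"
proof -
  define p where "p = (\<lambda>s. (1 / (A + B)) *\<^sub>R (J (T s) + B *\<^sub>R \<gamma> s))"
  define q where "q = (\<lambda>s. (1 / (A + B)) *\<^sub>R (A *\<^sub>R \<gamma> s - J (T s)))"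
  have a_AB: "1 / a = A * B" using AB by simp
  have pq: "\<gamma> s = p s + q s" for s
  proof -
    have "p s + q s = (1 / (A + B)) *\<^sub>R ((J (T s) + B *\<^sub>R \<gamma> s) + (A *\<^sub>R \<gamma> s - J (T s)))"
      by (simp only: p_def q_def scaleR_add_right)
    also have "(J (T s) + B *\<^sub>R \<gamma> s) + (A *\<^sub>R \<gamma> s - J (T s)) = (A + B) *\<^sub>R \<gamma> s"
      by (simp add: scaleR_add_left)
    finally show ?thesis using AB(2) by simp
  qed
  have "(p has_vector_derivative (- A) *\<^sub>R J (p s)) (at s within I)"
    and "(q has_vector_derivative B *\<^sub>R J (q s)) (at s within I)" if s: "s \<in> I" for s
  proof -
    have J2: "J (d 2 s) = - (A * B) *\<^sub>R J (\<gamma> s) - (B - A) *\<^sub>R T s"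
      by (simp add: J_acceleration[OF s] \<kappa>[OF s] a_AB)
    have "(p has_vector_derivative (1 / (A + B)) *\<^sub>R (J (d 2 s) + B *\<^sub>R T s)) (at s within I)"
      unfolding p_def
      by (intro bounded_linear.has_vector_derivative[OF bounded_linear_scaleR_right]
          has_vector_derivative_add J_derivative T_derivative \<gamma>_derivative s)
    moreover have "(q has_vector_derivative (1 / (A + B)) *\<^sub>R (A *\<^sub>R T s - J (d 2 s))) (at s within I)"
      unfolding q_def
      by (intro bounded_linear.has_vector_derivative[OF bounded_linear_scaleR_right]
          has_vector_derivative_diff J_derivative T_derivative \<gamma>_derivative s)
    moreover have "(1 / (A + B)) *\<^sub>R (J (d 2 s) + B *\<^sub>R T s) = (- A) *\<^sub>R J (p s)"
      "(1 / (A + B)) *\<^sub>R (A *\<^sub>R T s - J (d 2 s)) = B *\<^sub>R J (q s)"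
      unfolding J2
      by (simp add: p_def q_def J_add J_diff J_scale J_J vec_eq_iff; simp add: field_simps AB(2))+
    ultimately show "(p has_vector_derivative (- A) *\<^sub>R J (p s)) (at s within I)"
      "(q has_vector_derivative B *\<^sub>R J (q s)) (at s within I)" by simp_all
  qed
  moreover have cI: "convex I" using I by (simp add: is_interval_convex)
  ultimately obtain c1 c3 where c1: "\<And>s. s \<in> I \<Longrightarrow> p s = rot (- A * s) c1"
    and c3: "\<And>s. s \<in> I \<Longrightarrow> q s = rot (B * s) c3"
    using J_ode_unique[OF cI, of p "- A"] J_ode_unique[OF cI, of q B] by metis
  obtain s where s: "s \<in> I" using I(2) interior_subset by blast
  note f = frame[OF s]
  have f': "T s \<bullet> \<gamma> s = 0" "J (T s) \<bullet> \<gamma> s = 0" using f by (simp_all add: inner_commute)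
  have pq0: "p s \<bullet> q s = 0" "p s \<bullet> J (q s) = 0"
    and pp: "p s \<bullet> p s = B / (A + B)" and qq: "q s \<bullet> q s = A / (A + B)"
  proof -
    have Jq: "J (q s) = (1 / (A + B)) *\<^sub>R (A *\<^sub>R J (\<gamma> s) + T s)"
      by (simp add: q_def J_scale J_diff J_J)
    show "p s \<bullet> q s = 0"
      by (simp add: p_def q_def inner_add_left inner_diff_right J_inner f f' a_AB)
    show "p s \<bullet> J (q s) = 0"
      unfolding Jq by (simp add: p_def inner_add_left inner_add_right J_inner J_self f f')
    have "p s \<bullet> p s = (1 / (A + B)) * ((1 / (A + B)) * (B * (A + B)))"
    proof -
      have "(J (T s) + B *\<^sub>R \<gamma> s) \<bullet> (J (T s) + B *\<^sub>R \<gamma> s) = B * (A + B)"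
        by (simp add: inner_add_left inner_add_right J_inner f f' a_AB) (simp add: algebra_simps)
      then show ?thesis by (simp only: p_def inner_scaleR_left inner_scaleR_right)
    qed
    then show "p s \<bullet> p s = B / (A + B)" using AB(2) by simp
    have "q s \<bullet> q s = (1 / (A + B)) * ((1 / (A + B)) * (A * (A + B)))"
    proof -
      have "(A *\<^sub>R \<gamma> s - J (T s)) \<bullet> (A *\<^sub>R \<gamma> s - J (T s)) = A * (A + B)"
        by (simp add: inner_diff_left inner_diff_right J_inner f f' a_AB) (simp add: algebra_simps)
      then show ?thesis by (simp only: q_def inner_scaleR_left inner_scaleR_right)
    qed
    then show "q s \<bullet> q s = A / (A + B)" using AB(2) by simp
  qed
  have c1': "c1 = rot (A * s) (p s)" and c3': "c3 = rot (- B * s) (q s)"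
    using c1[OF s] c3[OF s] by (simp_all add: rot_rot rot_0)
  have c: "c1 \<bullet> c1 = B / (A + B)" "c3 \<bullet> c3 = A / (A + B)" "c1 \<bullet> c3 = 0" "c3 \<bullet> J c1 = 0"
  proof -
    show "c1 \<bullet> c1 = B / (A + B)" "c3 \<bullet> c3 = A / (A + B)" "c1 \<bullet> c3 = 0"
      unfolding c1' c3' inner_rot_self using pp qq inner_rot_orthogonal[OF pq0] by auto
    have "q s \<bullet> J (p s) = 0" using pq0(2) J_skew[of "p s" "q s"] by (simp add: inner_commute)
    then have "rot \<alpha> (q s) \<bullet> rot \<beta> (J (p s)) = 0" for \<alpha> \<beta>
      using pq0 by (intro inner_rot_orthogonal) (simp_all add: J_J inner_commute)
    then show "c3 \<bullet> J c1 = 0" unfolding c1' c3' rot_J[symmetric] .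
  qed
  have "A \<noteq> 0" "B \<noteq> 0" using AB a by auto
  then have "c1 \<noteq> 0" "c3 \<noteq> 0" using c(1,2) AB(2) by auto
  show ?thesis
  proof (rule that)
    show "norm (c1 /\<^sub>R norm c1) = 1" "norm (c3 /\<^sub>R norm c3) = 1"
      using \<open>c1 \<noteq> 0\<close> \<open>c3 \<noteq> 0\<close> by simp_all
    show "(c1 /\<^sub>R norm c1) \<bullet> (c3 /\<^sub>R norm c3) = 0" "(c3 /\<^sub>R norm c3) \<bullet> J (c1 /\<^sub>R norm c1) = 0"
      using c(3,4) by (simp_all add: J_scale)
    have "sqrt (B / (A + B)) *\<^sub>R (c1 /\<^sub>R norm c1) = c1" "sqrt (A / (A + B)) *\<^sub>R (c3 /\<^sub>R norm c3) = c3"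
      unfolding c(1,2)[symmetric] norm_eq_sqrt_inner[symmetric]
      using \<open>c1 \<noteq> 0\<close> \<open>c3 \<noteq> 0\<close> by simp_all
    then show "\<gamma> s = rot (- A * s) (sqrt (B / (A + B)) *\<^sub>R (c1 /\<^sub>R norm c1))
        + rot (B * s) (sqrt (A / (A + B)) *\<^sub>R (c3 /\<^sub>R norm c3))" if "s \<in> I" for s
      using pq c1[OF that] c3[OF that] by simp
  qed
qed

text \<open>Differentiating the sum twice gives the same complex equation, and comparison with
  \<open>acceleration\<close> isolates the curvature, the coefficient of \<open>J T \<noteq> 0\<close>.\<close>
lemma helix_imp_constant_curvature:
  assumes AB: "A * B = 1 / a"
    and h: "\<And>s. s \<in> I \<Longrightarrow> \<gamma> s = rot (- A * s) c1 + rot (B * s) c3" and s: "s \<in> I"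
  shows "\<kappa> s = B - A"
proof -
  have r: "((\<lambda>t. rot (\<mu> * t) c) has_vector_derivative \<mu> *\<^sub>R rot (\<mu> * t) (J c)) (at t within I)" for \<mu> c t
    using rot_derivative[OF has_vector_derivative_const, of \<mu> c t I] by (simp add: rot_scale)
  have T: "T t = - A *\<^sub>R rot (- A * t) (J c1) + B *\<^sub>R rot (B * t) (J c3)" if t: "t \<in> I" for t
    using vector_derivative_eqI[OF t has_vector_derivative_add[OF r r] h]
      vector_derivative_eqI[OF t \<gamma>_derivative[OF t], of \<gamma>] by simp
  have "((\<lambda>t. - A *\<^sub>R rot (- A * t) (J c1) + B *\<^sub>R rot (B * t) (J c3)) has_vector_derivative
      - A *\<^sub>R (- A *\<^sub>R rot (- A * s) (J (J c1))) + B *\<^sub>R (B *\<^sub>R rot (B * s) (J (J c3)))) (at s within I)"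
    by (intro has_vector_derivative_add bounded_linear.has_vector_derivative[OF bounded_linear_scaleR_right] r)
  from vector_derivative_eqI[OF s this T] vector_derivative_eqI[OF s T_derivative[OF s], of T]
  have "d 2 s = - (A\<^sup>2) *\<^sub>R rot (- A * s) c1 - B\<^sup>2 *\<^sub>R rot (B * s) c3"
    by (simp add: rot_J J_J rot_minus power2_eq_square)
  also have "\<dots> = - (A * B) *\<^sub>R \<gamma> s + (B - A) *\<^sub>R J (T s)"
    unfolding h[OF s] T[OF s]
    by (simp add: J_add J_scale rot_J J_J vec_eq_iff J_diff) (simp add: algebra_simps power2_eq_square)
  finally have "\<kappa> s *\<^sub>R J (T s) = (B - A) *\<^sub>R J (T s)"
    unfolding acceleration[OF s] AB by simp
  moreover have "J (T s) \<noteq> 0" using frame(5)[OF s] J_inner[of "T s" "T s"] a by auto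
  ultimately show ?thesis by simp
qed

end

section \<open>Proper-biharmonic Legendre curves\<close>

text \<open>Everything rests on \<open>(3 - 2 a)\<^sup>2 - 4 (a - 1) (a - 2) = 1\<close>.\<close>
lemma frequencies:
  fixes a :: real
  assumes a: "0 < a" "a < 1"
    and A: "A = sqrt ((3 - 2 * a - 2 * sqrt ((a - 1) * (a - 2))) / a)"
    and B: "B = sqrt ((3 - 2 * a + 2 * sqrt ((a - 1) * (a - 2))) / a)"
  shows "A * B = 1 / a" "(B - A)\<^sup>2 = 4 / a - 4" "0 < A" "0 < B"
proof -
  define r where "r = sqrt ((a - 1) * (a - 2))"
  have nn: "0 \<le> (a - 1) * (a - 2)" using a by (simp add: zero_le_mult_iff)
  then have r0: "0 \<le> r" by (simp add: r_def)
  have r: "r\<^sup>2 = (a - 1) * (a - 2)" unfolding r_def by (rule real_sqrt_pow2[OF nn])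
  have prod: "(3 - 2 * a - 2 * r) * (3 - 2 * a + 2 * r) = 1"
    using r by (simp add: power2_eq_square algebra_simps)
  have pos: "0 < 3 - 2 * a + 2 * r" using r0 a by simp
  then have pos': "0 < 3 - 2 * a - 2 * r"
    using prod by (metis zero_less_mult_pos2 zero_less_one)
  show "0 < A" "0 < B" using pos pos' a by (simp_all add: A B r_def)
  show AB: "A * B = 1 / a"
    using prod a unfolding A B r_def[symmetric] real_sqrt_mult[symmetric]
    by (simp add: real_sqrt_divide)
  have "A\<^sup>2 = (3 - 2 * a - 2 * r) / a" "B\<^sup>2 = (3 - 2 * a + 2 * r) / a"
    unfolding A B r_def[symmetric] using pos pos' a by (simp_all add: real_sqrt_pow2)
  then have "(B - A)\<^sup>2 = (3 - 2 * a + 2 * r) / a + (3 - 2 * a - 2 * r) / a - 2 * (1 / a)"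
    unfolding AB[symmetric] by (simp add: power2_diff algebra_simps)
  also have "\<dots> = 4 / a - 4" using a by (simp add: field_simps)
  finally show "(B - A)\<^sup>2 = 4 / a - 4" .
qed

theorem theorem3p1:
  fixes a A B :: real and I :: "real set" and \<gamma> :: "real \<Rightarrow> R4"
  assumes "0 < a" and "a < 1"
    and A: "A = sqrt ((3 - 2 * a - 2 * sqrt ((a - 1) * (a - 2))) / a)"
    and B: "B = sqrt ((3 - 2 * a + 2 * sqrt ((a - 1) * (a - 2))) / a)"
    and "is_interval I" and "interior I \<noteq> {}"
    and "smooth_curve I \<gamma>" and "\<gamma> ` I \<subseteq> S3"
    and "legendre a I \<gamma>" and "arc_length_param (gmetric a) I \<gamma>"
  shows "proper_biharmonic (gmetric a) I \<gamma> \<longleftrightarrow>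
    (\<exists>\<sigma>\<in>{1, - 1}. \<exists>e1 e3. norm e1 = 1 \<and> norm e3 = 1 \<and> e1 \<bullet> e3 = 0 \<and> e3 \<bullet> J e1 = 0 \<and>
      (\<forall>s\<in>I. \<gamma> s =
          (sqrt (B / (A + B)) * cos (A * (\<sigma> * s))) *\<^sub>R e1
        - (sqrt (B / (A + B)) * sin (A * (\<sigma> * s))) *\<^sub>R J e1
        + (sqrt (A / (A + B)) * cos (B * (\<sigma> * s))) *\<^sub>R e3
        + (sqrt (A / (A + B)) * sin (B * (\<sigma> * s))) *\<^sub>R J e3))"
    (is "_ \<longleftrightarrow> (\<exists>\<sigma>\<in>_. \<exists>e1 e3. _ \<and> _ \<and> _ \<and> _ \<and> (\<forall>s\<in>I. \<gamma> s = ?helix \<sigma> e1 e3 s))")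
proof -
  obtain d where d: "\<And>s. s \<in> I \<Longrightarrow> d 0 s = \<gamma> s"
    "\<And>n s. s \<in> I \<Longrightarrow> (d n has_vector_derivative d (Suc n) s) (at s within I)"
    using assms(7) unfolding smooth_curve_def by blast
  interpret legendre_curve a I \<gamma> d
    using assms d by unfold_locales auto
  note freq = frequencies[OF assms(1,2) A B]
  \<comment> \<open>The sign \<open>\<sigma>\<close> of the curvature is absorbed into both frequencies; the amplitudes are quotients
    and do not change.\<close>
  have helix: "?helix \<sigma> e1 e3 s = rot (- (\<sigma> * A) * s) (sqrt (B / (A + B)) *\<^sub>R e1)
      + rot (\<sigma> * B * s) (sqrt (A / (A + B)) *\<^sub>R e3)" for \<sigma> e1 e3 s
    by (simp add: rot_def J_scale mult.assoc mult.commute mult.left_commute)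
  have \<sigma>: "\<sigma> * A * (\<sigma> * B) = 1 / a" "\<sigma> * A + \<sigma> * B \<noteq> 0"
    "\<sigma> * B / (\<sigma> * A + \<sigma> * B) = B / (A + B)" "\<sigma> * A / (\<sigma> * A + \<sigma> * B) = A / (A + B)"
    if "\<sigma> \<in> {1, - 1}" for \<sigma>
  proof -
    have "- A - B \<noteq> 0" "A + B \<noteq> 0" using freq by auto
    then show "\<sigma> * A * (\<sigma> * B) = 1 / a" "\<sigma> * A + \<sigma> * B \<noteq> 0"
      "\<sigma> * B / (\<sigma> * A + \<sigma> * B) = B / (A + B)" "\<sigma> * A / (\<sigma> * A + \<sigma> * B) = A / (A + B)"
      using that freq by (auto simp: divide_simps)
  qed
  have "proper_biharmonic (gmetric a) I \<gamma> \<longleftrightarrow> (\<exists>c. c\<^sup>2 = (B - A)\<^sup>2 \<and> (\<forall>s\<in>I. \<kappa> s = c))"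
    by (simp add: proper_biharmonic_iff freq)
  also have "\<dots> \<longleftrightarrow> (\<exists>\<sigma>\<in>{1, - 1}. \<forall>s\<in>I. \<kappa> s = \<sigma> * B - \<sigma> * A)"
    by (auto simp: power2_eq_iff)
  also have "\<dots> \<longleftrightarrow> (\<exists>\<sigma>\<in>{1, - 1}. \<exists>e1 e3. norm e1 = 1 \<and> norm e3 = 1 \<and> e1 \<bullet> e3 = 0 \<and>
      e3 \<bullet> J e1 = 0 \<and> (\<forall>s\<in>I. \<gamma> s = ?helix \<sigma> e1 e3 s))"
  proof (rule bex_cong[OF refl])
    fix \<sigma> :: real assume s: "\<sigma> \<in> {1, - 1}"
    show "(\<forall>s\<in>I. \<kappa> s = \<sigma> * B - \<sigma> * A) \<longleftrightarrow> (\<exists>e1 e3. norm e1 = 1 \<and> norm e3 = 1 \<and> e1 \<bullet> e3 = 0 \<and>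
      e3 \<bullet> J e1 = 0 \<and> (\<forall>s\<in>I. \<gamma> s = ?helix \<sigma> e1 e3 s))" (is "?K \<longleftrightarrow> ?H")
    proof
      assume ?K
      then obtain e1 e3 where "norm e1 = 1" "norm e3 = 1" "e1 \<bullet> e3 = 0" "e3 \<bullet> J e1 = 0"
        "\<And>s. s \<in> I \<Longrightarrow> \<gamma> s = rot (- (\<sigma> * A) * s) (sqrt (B / (A + B)) *\<^sub>R e1)
          + rot (\<sigma> * B * s) (sqrt (A / (A + B)) *\<^sub>R e3)"
        using constant_curvature_imp_helix[OF \<sigma>(1,2)[OF s]] unfolding \<sigma>(3,4)[OF s] by blast
      then show ?H unfolding helix by blast
    next
      assume ?H
      then show ?K
        using helix_imp_constant_curvature[OF \<sigma>(1)[OF s]] unfolding helix by blast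
    qed
  qed
  finally show ?thesis .
qed

end
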